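(* Let $G$ be a finite group and let $p$ be a fixed prime divisor of $|G|$. Suppose that every maximal subgroup of $G$ is nilpotent, or normal in $G$, or has order not divisible by $p$. Then there exists at most one prime divisor $q$ of $|G|$ with $q\neq p$ such that $G$ is neither $q$-nilpotent nor $q$-closed.
   Context: For a prime $q$, a finite group $G$ is $q$-nilpotent if it has a normal $q$-complement (a normal subgroup of order coprime to $q$ and index a power of $q$), and $q$-closed if its Sylow $q$-subgroup is normal in $G$. *)

theory Defs
  imports "HOL-Algebra.Algebra"
begin

definition maximal_subgroup :: "('a, 'b) monoid_scheme \<Rightarrow> 'a set \<Rightarrow> bool" where
  "maximal_subgroup G M \<longleftrightarrow> subgroup M G \<and> M \<noteq> carrier G \<and>
     (\<forall>H. subgroup H G \<and> M \<subseteq> H \<longrightarrow> H = M \<or> H = carrier G)"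

primrec lower_central :: "('a, 'b) monoid_scheme \<Rightarrow> nat \<Rightarrow> 'a set" where
  "lower_central G 0 = carrier G"
| "lower_central G (Suc n) = generate G
     {x \<otimes>\<^bsub>G\<^esub> y \<otimes>\<^bsub>G\<^esub> inv\<^bsub>G\<^esub> x \<otimes>\<^bsub>G\<^esub> inv\<^bsub>G\<^esub> y | x y. x \<in> lower_central G n \<and> y \<in> carrier G}"

definition nilpotent_group :: "('a, 'b) monoid_scheme \<Rightarrow> bool" where
  "nilpotent_group G \<longleftrightarrow> group G \<and> (\<exists>n. lower_central G n = {\<one>\<^bsub>G\<^esub>})"

definition sylow_subgroup :: "('a, 'b) monoid_scheme \<Rightarrow> nat \<Rightarrow> 'a set \<Rightarrow> bool" where
  "sylow_subgroup G q P \<longleftrightarrow> subgroup P G \<and> card P = q ^ multiplicity q (order G)"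

definition q_closed :: "('a, 'b) monoid_scheme \<Rightarrow> nat \<Rightarrow> bool" where
  "q_closed G q \<longleftrightarrow> (\<exists>P. sylow_subgroup G q P \<and> P \<lhd> G)"

definition q_nilpotent :: "('a, 'b) monoid_scheme \<Rightarrow> nat \<Rightarrow> bool" where
  "q_nilpotent G q \<longleftrightarrow> (\<exists>N. N \<lhd> G \<and> coprime (card N) q \<and> (\<exists>k. order G = q ^ k * card N))"

end

(*
  Let Z be normal in G and S a Sylow s-subgroup with Z S not normal, and assume that the maximal
  subgroups above Z of order divisible by s are normal or nilpotent.  By Frattini, a maximal subgroup
  M above the normalizer of Z S is not normal, hence nilpotent, hence M = N(S).  Let D be the core of
  M and L a minimal normal subgroup of G above D, so that G = L M.

  If s divides |G : L|, take a prime q dividing the index of the intersection of L and M in L, and a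
  Sylow q-subgroup Q of L.  Unless Z Q is normal in G, a maximal subgroup above N(Z Q) is nilpotent of
  order divisible by s, which makes it a conjugate of M; this contradicts the choice of q.  So Z Q is
  normal and G = Z Q M.
  If s does not divide |G : L|, then S lies in L, the s-complement of M centralizes S and covers G / L,
  and it follows that distinct conjugates of S intersect inside D.  The transfer from G to an abelian
  quotient of M by a maximal subgroup above D and the s-complement restricts to S as the projection,
  and then its kernel can meet L neither in D nor in L, a contradiction.

  From G = Z Q M with Q a t-group and M nilpotent, G is r-nilpotent for every prime r other than t
  that does not divide |Z|.  The theorem is the case Z = 1, s = p if the Sylow p-subgroup P is not
  normal, and otherwise the case Z = P with any s such that P S is not normal; if there is no such s,
  then G is r-nilpotent for all r other than p.
*)

theory Submission
  imports Defs
begin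

section \<open>Conjugation and normalizers in a finite group\<close>

locale fin_group = group G for G (structure) +
  assumes fin: "finite (carrier G)"
begin

lemma inv_cancel [simp]:
  assumes "x \<in> carrier G" "y \<in> carrier G"
  shows "x \<otimes> (inv x \<otimes> y) = y" "inv x \<otimes> (x \<otimes> y) = y"
  using assms by (simp_all flip: m_assoc)

lemmas grp = m_assoc inv_mult_group

definition conj_set :: "'a \<Rightarrow> 'a set \<Rightarrow> 'a set" where
  "conj_set g A = (\<lambda>x. g \<otimes> x \<otimes> inv g) ` A"

definition normaliser :: "'a set \<Rightarrow> 'a set" where
  "normaliser U = {g \<in> carrier G. conj_set g U = U}"

text \<open>Relative normality is a property of subsets of the ambient group, so that subgroups at
  several levels can be compared without changing the group structure.\<close>

definition normal_in :: "'a set \<Rightarrow> 'a set \<Rightarrow> bool" where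
  "normal_in N K \<longleftrightarrow> subgroup N G \<and> subgroup K G \<and> N \<subseteq> K \<and> (\<forall>g\<in>K. \<forall>x\<in>N. g \<otimes> x \<otimes> inv g \<in> N)"

text \<open>The exponent is left open: being a \<open>q\<close>-group of index prime to
  \<open>q\<close> passes at once to the subgroups between \<open>Q\<close> and \<open>L\<close>.
  \<open>sylow_card\<close> recovers the exponent.\<close>

definition sylow_in :: "nat \<Rightarrow> 'a set \<Rightarrow> 'a set \<Rightarrow> bool" where
  "sylow_in q Q L \<longleftrightarrow> subgroup Q G \<and> subgroup L G \<and> Q \<subseteq> L \<and> (\<exists>k. card Q = q ^ k) \<and>
     \<not> q dvd card L div card Q"

lemma subgroup_carr: "subgroup A G \<Longrightarrow> A \<subseteq> carrier G"
  by (rule subgroup.subset)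

lemma subgroup_finite: "subgroup A G \<Longrightarrow> finite A"
  using subgroup_carr fin finite_subset by blast

lemma subgroup_card_pos: "subgroup A G \<Longrightarrow> 0 < card A"
  using subgroup_finite subgroup.one_closed by (metis card_gt_0_iff empty_iff)

lemma subgroup_card_dvd:
  assumes "subgroup A G" "subgroup B G" "A \<subseteq> B"
  shows "card A dvd card B"
proof -
  interpret B: group "G\<lparr>carrier := B\<rparr>" using assms(2) by (rule subgroup_imp_group)
  have "subgroup A (G\<lparr>carrier := B\<rparr>)" using assms by (simp add: subgroup_incl)
  from B.lagrange[OF this] have "card (rcosets\<^bsub>G\<lparr>carrier := B\<rparr>\<^esub> A) * card A = card B"
    by (simp add: order_def)
  then show ?thesis by (metis dvd_triv_right)
qed

lemma conj_set_mem: "\<lbrakk>g \<in> carrier G; A \<subseteq> carrier G; x \<in> carrier G\<rbrakk> \<Longrightarrow> x \<in> conj_set g A \<longleftrightarrow> inv g \<otimes> x \<otimes> g \<in> A"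
  unfolding conj_set_def image_iff
proof
  assume a: "g \<in> carrier G" "A \<subseteq> carrier G" "x \<in> carrier G"
  { assume "inv g \<otimes> x \<otimes> g \<in> A"
    moreover have "x = g \<otimes> (inv g \<otimes> x \<otimes> g) \<otimes> inv g" using a by (simp add: grp)
    ultimately show "\<exists>y\<in>A. x = g \<otimes> y \<otimes> inv g" by blast }
  { assume "\<exists>y\<in>A. x = g \<otimes> y \<otimes> inv g"
    then obtain y where "y \<in> A" "x = g \<otimes> y \<otimes> inv g" by blast
    with a show "inv g \<otimes> x \<otimes> g \<in> A" by (simp add: grp subset_iff) }
qed

lemma conj_set_carrier: "\<lbrakk>g \<in> carrier G; A \<subseteq> carrier G\<rbrakk> \<Longrightarrow> conj_set g A \<subseteq> carrier G"
  unfolding conj_set_def by auto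

lemma conj_set_mono: "A \<subseteq> B \<Longrightarrow> conj_set g A \<subseteq> conj_set g B"
  unfolding conj_set_def by auto

lemma conj_set_comp: "\<lbrakk>g \<in> carrier G; h \<in> carrier G; A \<subseteq> carrier G\<rbrakk> \<Longrightarrow> conj_set g (conj_set h A) = conj_set (g \<otimes> h) A"
  unfolding conj_set_def image_image by (rule image_cong) (auto simp: grp subset_iff)

lemma conj_set_one [simp]: "A \<subseteq> carrier G \<Longrightarrow> conj_set \<one> A = A"
  unfolding conj_set_def by (auto simp: subset_iff image_iff)

lemma conj_set_inv [simp]: "\<lbrakk>g \<in> carrier G; A \<subseteq> carrier G\<rbrakk> \<Longrightarrow> conj_set (inv g) (conj_set g A) = A"
  "\<lbrakk>g \<in> carrier G; A \<subseteq> carrier G\<rbrakk> \<Longrightarrow> conj_set g (conj_set (inv g) A) = A"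
  by (simp_all add: conj_set_comp)

lemma conj_set_card [simp]: "\<lbrakk>g \<in> carrier G; A \<subseteq> carrier G\<rbrakk> \<Longrightarrow> card (conj_set g A) = card A"
  unfolding conj_set_def by (rule card_image) (auto simp: inj_on_def subset_iff)

lemma conj_set_subgroup: assumes "g \<in> carrier G" "subgroup A G" shows "subgroup (conj_set g A) G"
proof (rule subgroupI)
  note A = subgroup_carr[OF assms(2)]
  show "conj_set g A \<subseteq> carrier G" using conj_set_carrier assms A by simp
  show "conj_set g A \<noteq> {}" unfolding conj_set_def using assms(2) subgroup.one_closed by blast
  fix a assume "a \<in> conj_set g A"
  then obtain x where x: "x \<in> A" "a = g \<otimes> x \<otimes> inv g" unfolding conj_set_def by blast
  then have "inv a = g \<otimes> inv x \<otimes> inv g" using A assms by (auto simp: grp subset_iff)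
  then show "inv a \<in> conj_set g A" unfolding conj_set_def using assms(2) x by (auto intro: subgroup.m_inv_closed)
  fix b assume "b \<in> conj_set g A"
  then obtain y where y: "y \<in> A" "b = g \<otimes> y \<otimes> inv g" unfolding conj_set_def by blast
  have "a \<otimes> b = g \<otimes> (x \<otimes> y) \<otimes> inv g" using x y A assms by (auto simp: grp subset_iff)
  then show "a \<otimes> b \<in> conj_set g A" unfolding conj_set_def using assms(2) x y by (auto intro: subgroup.m_closed)
qed

lemma conj_set_self: assumes "subgroup A G" "g \<in> A" shows "conj_set g A = A"
proof (rule card_subset_eq)
  have g: "g \<in> carrier G" using assms subgroup_carr by blast
  show "finite A" using assms subgroup_finite by simp
  show "conj_set g A \<subseteq> A" unfolding conj_set_def using assms by (auto intro!: subgroup.m_closed subgroup.m_inv_closed)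
  show "card (conj_set g A) = card A" using g assms subgroup_carr by simp
qed

text \<open>Conjugation preserves cardinality, so one inclusion between finite sets
  suffices.\<close>

lemma conj_set_eqI: assumes "g \<in> carrier G" "A \<subseteq> carrier G" "conj_set g A \<subseteq> A" shows "conj_set g A = A"
  by (rule card_subset_eq) (use assms fin finite_subset in auto)

lemma normaliser_iff: "A \<subseteq> carrier G \<Longrightarrow> g \<in> normaliser A \<longleftrightarrow> g \<in> carrier G \<and> (\<forall>x\<in>A. g \<otimes> x \<otimes> inv g \<in> A)"
  unfolding normaliser_def using conj_set_eqI[of g A] by (auto simp: conj_set_def)

lemma normaliser_subgroup: assumes "U \<subseteq> carrier G" shows "subgroup (normaliser U) G"
proof (rule subgroupI)
  show "normaliser U \<subseteq> carrier G" unfolding normaliser_def by auto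
  show "normaliser U \<noteq> {}" unfolding normaliser_def using assms by (auto intro!: exI[of _ \<one>])
  fix a assume a: "a \<in> normaliser U"
  then show "inv a \<in> normaliser U" unfolding normaliser_def using assms conj_set_inv(1)[of a U] by auto
  fix b assume "b \<in> normaliser U"
  with a show "a \<otimes> b \<in> normaliser U" unfolding normaliser_def using assms by (auto simp flip: conj_set_comp)
qed

lemma normaliser_self: "subgroup A G \<Longrightarrow> A \<subseteq> normaliser A"
  unfolding normaliser_def using conj_set_self subgroup_carr by blast

lemma normaliser_cj: assumes "g \<in> carrier G" "U \<subseteq> carrier G" shows "normaliser (conj_set g U) = conj_set g (normaliser U)"
proof -
  have "a \<in> normaliser (conj_set g U) \<longleftrightarrow> a \<in> conj_set g (normaliser U)" if a: "a \<in> carrier G" for a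
  proof -
    have "a \<in> normaliser (conj_set g U) \<longleftrightarrow> conj_set a (conj_set g U) = conj_set g U" unfolding normaliser_def using a by simp
    also have "\<dots> \<longleftrightarrow> conj_set (inv g) (conj_set a (conj_set g U)) = U"
      using assms a by (metis conj_set_carrier conj_set_inv)
    also have "\<dots> \<longleftrightarrow> conj_set (inv g \<otimes> a \<otimes> g) U = U" using assms a by (simp add: conj_set_comp conj_set_carrier grp)
    also have "\<dots> \<longleftrightarrow> a \<in> conj_set g (normaliser U)"
      using assms a normaliser_subgroup[of U, THEN subgroup_carr] by (subst conj_set_mem) (auto simp: normaliser_def)
    finally show ?thesis .
  qed
  moreover have "normaliser (conj_set g U) \<subseteq> carrier G" "conj_set g (normaliser U) \<subseteq> carrier G"
    using assms conj_set_carrier normaliser_subgroup[THEN subgroup_carr] by auto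
  ultimately show ?thesis by blast
qed

section \<open>Relative normality and products of subgroups\<close>

lemma normal_inD:
  assumes "normal_in N K"
  shows "subgroup N G" "subgroup K G" "N \<subseteq> K" "\<And>g x. g \<in> K \<Longrightarrow> x \<in> N \<Longrightarrow> g \<otimes> x \<otimes> inv g \<in> N"
    "K \<subseteq> normaliser N" "\<And>g. g \<in> K \<Longrightarrow> conj_set g N = N"
proof -
  show *: "subgroup N G" "subgroup K G" "N \<subseteq> K" "\<And>g x. g \<in> K \<Longrightarrow> x \<in> N \<Longrightarrow> g \<otimes> x \<otimes> inv g \<in> N"
    using assms unfolding normal_in_def by auto
  show **: "K \<subseteq> normaliser N"
  proof
    fix g assume "g \<in> K"
    then show "g \<in> normaliser N" using * subgroup_carr[of N] subgroup_carr[of K] by (subst normaliser_iff) auto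
  qed
  show "\<And>g. g \<in> K \<Longrightarrow> conj_set g N = N" using ** unfolding normaliser_def by blast
qed

lemma normal_in_iff: "normal_in N K \<longleftrightarrow> subgroup N G \<and> subgroup K G \<and> N \<subseteq> K \<and> K \<subseteq> normaliser N"
    using normal_inD(1,2,3,5)[of N K] normaliser_iff[of N] subgroup_carr[of N] unfolding normal_in_def by blast

lemma normal_iff: "N \<lhd> G \<longleftrightarrow> normal_in N (carrier G)"
  unfolding normal_in_def using normal_inv_iff subgroup_self subgroup_carr by blast

lemma subgroup_Int: "\<lbrakk>subgroup A G; subgroup B G\<rbrakk> \<Longrightarrow> subgroup (A \<inter> B) G"
  by (rule subgroups_Inter_pair)

lemma normal_in_Int: "\<lbrakk>normal_in A K; normal_in B K\<rbrakk> \<Longrightarrow> normal_in (A \<inter> B) K"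
  unfolding normal_in_def using subgroup_Int by auto

lemma normal_in_Int_subgroup:
  assumes "normal_in A K" "subgroup B G" "B \<subseteq> K"
  shows "normal_in (A \<inter> B) B"
proof -
  have "g \<otimes> x \<otimes> inv g \<in> B" if "g \<in> B" "x \<in> B" for g x
    using that assms(2) by (intro subgroup.m_closed subgroup.m_inv_closed)
  then show ?thesis using assms subgroup_Int unfolding normal_in_def by blast
qed

lemma set_mult_mem: "x \<in> A <#> B \<longleftrightarrow> (\<exists>a\<in>A. \<exists>b\<in>B. x = a \<otimes> b)"
  unfolding set_mult_def by auto

lemma set_mult_subgroup:
  assumes A: "subgroup A G" and B: "subgroup B G" and n: "B \<subseteq> normaliser A"
  shows "subgroup (A <#> B) G"
proof (rule subgroupI)
  note c = subgroup_carr[OF A] subgroup_carr[OF B]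
  have cA: "b \<otimes> a \<otimes> inv b \<in> A" if "b \<in> B" "a \<in> A" for a b
    using n that normaliser_iff[OF c(1)] by auto
  show "A <#> B \<subseteq> carrier G" using c by (rule set_mult_closed)
  show "A <#> B \<noteq> {}" using subgroup.one_closed[OF A] subgroup.one_closed[OF B] unfolding set_mult_def by blast
  fix x assume "x \<in> A <#> B"
  then obtain a b where x: "a \<in> A" "b \<in> B" "x = a \<otimes> b" unfolding set_mult_mem by blast
  have "a \<in> carrier G" "b \<in> carrier G" using x c by auto
  then have "inv x = (inv b \<otimes> inv a \<otimes> inv (inv b)) \<otimes> inv b" using x by (simp add: grp)
  moreover have "inv b \<otimes> inv a \<otimes> inv (inv b) \<in> A" using x A B by (intro cA subgroup.m_inv_closed)
  ultimately show "inv x \<in> A <#> B" unfolding set_mult_mem using subgroup.m_inv_closed[OF B x(2)] by blast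
  fix y assume "y \<in> A <#> B"
  then obtain a' b' where y: "a' \<in> A" "b' \<in> B" "y = a' \<otimes> b'" unfolding set_mult_mem by blast
  have "a \<in> carrier G" "b \<in> carrier G" "a' \<in> carrier G" "b' \<in> carrier G" using x y c by auto
  then have "x \<otimes> y = (a \<otimes> (b \<otimes> a' \<otimes> inv b)) \<otimes> (b \<otimes> b')" using x y by (simp add: grp)
  moreover have "a \<otimes> (b \<otimes> a' \<otimes> inv b) \<in> A" using subgroup.m_closed[OF A x(1) cA[OF x(2) y(1)]] .
  ultimately show "x \<otimes> y \<in> A <#> B" unfolding set_mult_mem using subgroup.m_closed[OF B x(2) y(2)] by blast
qed

lemma set_mult_ub:
  assumes A: "subgroup A G" and B: "subgroup B G"
  shows "A \<subseteq> A <#> B" "B \<subseteq> A <#> B"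
proof
  fix x assume x: "x \<in> A"
  then have "x = x \<otimes> \<one>" using subgroup_carr[OF A] by auto
  then show "x \<in> A <#> B" unfolding set_mult_mem by (intro bexI[of _ x] bexI[of _ \<one>] x subgroup.one_closed[OF B])
next
  show "B \<subseteq> A <#> B"
  proof
    fix x assume x: "x \<in> B"
    then have "x = \<one> \<otimes> x" using subgroup_carr[OF B] by auto
    then show "x \<in> A <#> B" unfolding set_mult_mem by (intro bexI[of _ x] bexI[of _ \<one>] x subgroup.one_closed[OF A])
  qed
qed

lemma set_mult_least: "\<lbrakk>subgroup C G; A \<subseteq> C; B \<subseteq> C\<rbrakk> \<Longrightarrow> A <#> B \<subseteq> C"
  unfolding set_mult_def by (auto intro: subgroup.m_closed)

text \<open>An element \<open>a \<otimes> b\<close> has exactly the factorizations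
  \<open>(a \<otimes> d, inv d \<otimes> b)\<close> with \<open>d\<close> in
  \<open>A \<inter> B\<close>, so all fibres of multiplication on \<open>A \<times> B\<close> have
  the same size.\<close>

lemma card_set_mult:
  assumes A: "subgroup A G" and B: "subgroup B G"
  shows "card (A <#> B) * card (A \<inter> B) = card A * card B"
proof -
  note c = subgroup_carr[OF A] subgroup_carr[OF B]
  let ?f = "\<lambda>(a, b). a \<otimes> b"
  let ?F = "\<lambda>x. {p \<in> A \<times> B. ?f p = x}"
  have "card (?F x) = card (A \<inter> B)" if xAB: "x \<in> A <#> B" for x
  proof -
    obtain a b where x: "a \<in> A" "b \<in> B" "x = a \<otimes> b" using xAB unfolding set_mult_mem by blast
    have "bij_betw (\<lambda>d. (a \<otimes> d, inv d \<otimes> b)) (A \<inter> B) (?F x)"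
    proof (rule bij_betwI[where g = "\<lambda>(u, v). inv a \<otimes> u"])
      show "(\<lambda>d. (a \<otimes> d, inv d \<otimes> b)) \<in> A \<inter> B \<rightarrow> ?F x"
      proof
        fix d assume d: "d \<in> A \<inter> B"
        have "a \<in> carrier G" "b \<in> carrier G" "d \<in> carrier G" using x d c by auto
        then have "a \<otimes> d \<otimes> (inv d \<otimes> b) = x" using x by (simp add: grp)
        then show "(a \<otimes> d, inv d \<otimes> b) \<in> ?F x"
          using x d A B by (simp add: subgroup.m_closed subgroup.m_inv_closed)
      qed
      show "(\<lambda>(u, v). inv a \<otimes> u) \<in> ?F x \<rightarrow> A \<inter> B"
      proof
        fix z assume "z \<in> ?F x"
        then obtain u v where z: "z = (u, v)" and uv: "u \<in> A" "v \<in> B" "u \<otimes> v = x" by auto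
        have m: "u \<in> carrier G" "v \<in> carrier G" "a \<in> carrier G" "b \<in> carrier G" using uv x c by auto
        have "inv a \<otimes> (u \<otimes> v) \<otimes> inv v = inv a \<otimes> (a \<otimes> b) \<otimes> inv v" using uv(3) x(3) by simp
        then have "inv a \<otimes> u = b \<otimes> inv v" using m by (simp add: grp)
        then have "inv a \<otimes> u \<in> A \<and> inv a \<otimes> u \<in> B"
          using subgroup.m_closed[OF A subgroup.m_inv_closed[OF A x(1)] uv(1)]
            subgroup.m_closed[OF B x(2) subgroup.m_inv_closed[OF B uv(2)]] by simp
        then show "(\<lambda>(u, v). inv a \<otimes> u) z \<in> A \<inter> B" using z by simp
      qed
      show "(\<lambda>(u, v). inv a \<otimes> u) (a \<otimes> d, inv d \<otimes> b) = d" if "d \<in> A \<inter> B" for d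
        using that x c by (auto simp: subset_iff)
      show "\<And>p. p \<in> ?F x \<Longrightarrow> (\<lambda>d. (a \<otimes> d, inv d \<otimes> b)) ((\<lambda>(u, v). inv a \<otimes> u) p) = p"
      proof -
        fix p assume pF: "p \<in> ?F x"
        obtain u v where p: "p = (u, v)" by force
        with pF have uv: "u \<in> A" "v \<in> B" "u \<otimes> v = a \<otimes> b" using x by auto
        have m: "u \<in> carrier G" "v \<in> carrier G" "a \<in> carrier G" "b \<in> carrier G" using uv x c by auto
        have "inv (inv a \<otimes> u) \<otimes> b = inv u \<otimes> (a \<otimes> b)" using m by (simp add: grp)
        also have "\<dots> = inv u \<otimes> (u \<otimes> v)" using uv(3) by simp
        also have "\<dots> = v" using m by simp
        finally show "(\<lambda>d. (a \<otimes> d, inv d \<otimes> b)) ((\<lambda>(u, v). inv a \<otimes> u) p) = p" using p m by simp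
      qed
    qed
    then show ?thesis by (rule bij_betw_same_card[symmetric])
  qed
  then have "(\<Sum>x\<in>A <#> B. card (?F x)) = card (A <#> B) * card (A \<inter> B)" by simp
  moreover have "(\<Sum>x\<in>A <#> B. card (?F x)) = card (\<Union>x\<in>A <#> B. ?F x)"
    by (rule card_UN_disjoint[symmetric]) (use A B subgroup_finite set_mult_closed[OF c] fin finite_subset in auto)
  moreover have "(\<Union>x\<in>A <#> B. ?F x) = A \<times> B" unfolding set_mult_def by auto
  ultimately show ?thesis by (simp add: card_cartesian_product)
qed

subsection \<open>Sylow subgroups\<close>

lemma card_div:
  assumes "subgroup A G" "subgroup B G" "A \<subseteq> B"
  shows "card B = card B div card A * card A" "0 < card B div card A"
proof -
  show *: "card B = card B div card A * card A" using subgroup_card_dvd[OF assms] by simp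
  show "0 < card B div card A" using * subgroup_card_pos[OF assms(2)] by (metis mult_zero_left neq0_conv)
qed

lemma card_div_mult:
  assumes "subgroup A G" "subgroup B G" "subgroup C G" "A \<subseteq> B" "B \<subseteq> C"
  shows "card C div card A = (card C div card B) * (card B div card A)"
proof -
  have "card C = (card C div card B) * (card B div card A) * card A"
    using card_div(1)[OF assms(1,2,4)] card_div(1)[OF assms(2,3,5)] by (metis mult.assoc)
  then show ?thesis using subgroup_card_pos[OF assms(1)] by (metis nonzero_mult_div_cancel_right neq0_conv)
qed

lemma card_set_mult_div:
  assumes A: "subgroup A G" and B: "subgroup B G" and AB: "subgroup (A <#> B) G"
  shows "card (A <#> B) div card A = card B div card (A \<inter> B)"
proof -
  let ?i = "card (A \<inter> B)"
  have i: "0 < ?i" "0 < card A" using subgroup_card_pos subgroup_Int A B by auto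
  have "card (A <#> B) * ?i = card A * card B" using card_set_mult[OF A B] .
  moreover have "card B = card B div ?i * ?i" using card_div(1)[OF subgroup_Int[OF A B] B] by simp
  ultimately have "card (A <#> B) * ?i = (card A * (card B div ?i)) * ?i" by (metis mult.assoc)
  then have "card (A <#> B) = card A * (card B div ?i)" using i by simp
  then show ?thesis using i by simp
qed

lemma card_set_mult_dvd:
  assumes A: "subgroup A G" and B: "subgroup B G"
  shows "card (A <#> B) dvd card A * card B"
  using card_set_mult[OF A B] by (metis dvd_triv_left)

text \<open>Left translation by \<open>inv x\<close> turns the double coset into the product of
  \<open>conj_set (inv x) P\<close> and \<open>R\<close>, to which \<open>card_set_mult\<close>
  applies.\<close>

lemma double_coset_card:
  assumes P: "subgroup P G" and R: "subgroup R G" and x: "x \<in> carrier G"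
  shows "card {u \<otimes> x \<otimes> v | u v. u \<in> P \<and> v \<in> R} * card (conj_set (inv x) P \<inter> R) = card P * card R"
proof -
  note c = subgroup_carr[OF P] subgroup_carr[OF R]
  let ?P = "conj_set (inv x) P"
  have P': "subgroup ?P G" using P x by (simp add: conj_set_subgroup)
  have "{u \<otimes> x \<otimes> v | u v. u \<in> P \<and> v \<in> R} = (\<lambda>y. x \<otimes> y) ` (?P <#> R)" (is "?L = ?R")
  proof (intro equalityI subsetI)
    fix y assume "y \<in> ?L"
    then obtain u v where y: "u \<in> P" "v \<in> R" "y = u \<otimes> x \<otimes> v" by blast
    have m: "u \<in> carrier G" "v \<in> carrier G" using y c by auto
    have "y = x \<otimes> ((inv x \<otimes> u \<otimes> inv (inv x)) \<otimes> v)" using y(3) m x by (simp add: grp)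
    moreover have "inv x \<otimes> u \<otimes> inv (inv x) \<in> ?P" using y unfolding conj_set_def by blast
    ultimately show "y \<in> ?R" unfolding set_mult_def using y(2) by blast
  next
    fix y assume "y \<in> ?R"
    then obtain u v where y: "u \<in> P" "v \<in> R" "y = x \<otimes> ((inv x \<otimes> u \<otimes> inv (inv x)) \<otimes> v)"
      unfolding set_mult_def conj_set_def by blast
    have m: "u \<in> carrier G" "v \<in> carrier G" using y c by auto
    have "y = u \<otimes> x \<otimes> v" using y(3) m x by (simp add: grp)
    then show "y \<in> ?L" using y by blast
  qed
  moreover have "inj_on (\<lambda>y. x \<otimes> y) (?P <#> R)"
    using set_mult_closed[OF subgroup_carr[OF P'] c(2)] x by (auto simp: inj_on_def subset_iff)
  ultimately have "card ?L = card (?P <#> R)" by (simp add: card_image)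
  then show ?thesis using card_set_mult[OF P' R] x c by simp
qed

lemma sylow_inD:
  assumes "sylow_in q Q L"
  shows "subgroup Q G" "subgroup L G" "Q \<subseteq> L" "\<exists>k. card Q = q ^ k" "\<not> q dvd card L div card Q"
  using assms unfolding sylow_in_def by auto

lemma prime_power_dvd_cases:
  fixes q d :: nat
  assumes "Factorial_Ring.prime q" "d dvd q ^ k" "\<not> q dvd d"
  shows "d = 1"
  using assms by (metis divides_primepow_nat dvd_power gr0I power_0)

lemma p_subgroup_sub:
  assumes q: "Factorial_Ring.prime (q::nat)" and "subgroup A G" "subgroup B G" "A \<subseteq> B" "card B = q ^ k"
  shows "\<exists>j. card A = q ^ j"
  using subgroup_card_dvd[OF assms(2-4)] assms(5) divides_primepow_nat[OF q] by auto

text \<open>The double cosets \<open>P x R\<close> partition \<open>L\<close>; if no conjugate of \<open>P\<close> contained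
  \<open>R\<close>, their sizes would all be divisible by \<open>q |P|\<close>.\<close>
lemma sylow_conj:
  assumes q: "Factorial_Ring.prime q" and P: "sylow_in q P L"
    and R: "subgroup R G" "R \<subseteq> L" "card R = q ^ k"
  shows "\<exists>g\<in>L. R \<subseteq> conj_set g P"
proof (rule ccontr)
  assume neg: "\<not> ?thesis"
  note s = sylow_inD[OF P]
  note c = subgroup_carr[OF s(1)] subgroup_carr[OF s(2)] subgroup_carr[OF R(1)]
  define dc where "dc x = {u \<otimes> x \<otimes> v | u v. u \<in> P \<and> v \<in> R}" for x
  \<comment> \<open>By \<open>neg\<close>, the conjugate of \<open>P\<close> by \<open>inv x\<close>
    does not contain \<open>R\<close>, so it meets the \<open>q\<close>-group \<open>R\<close> in a
    proper subgroup, whose index is divisible by \<open>q\<close>.\<close>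
  have d: "q * card P dvd card (dc x)" if x: "x \<in> L" for x
  proof -
    have xc: "x \<in> carrier G" using x c by blast
    let ?I = "conj_set (inv x) P \<inter> R"
    have I: "subgroup ?I G" using s(1) R xc by (simp add: subgroup_Int conj_set_subgroup)
    have "inv x \<in> L" using x s(2) by (rule subgroup.m_inv_closed[rotated])
    then have "?I \<noteq> R" using neg by blast
    have ir: "card R = card R div card ?I * card ?I" "0 < card R div card ?I"
      using card_div[OF I R(1)] by auto
    have "q dvd card R div card ?I"
    proof (rule ccontr)
      assume "\<not> q dvd card R div card ?I"
      moreover have "card R div card ?I dvd q ^ k" using ir(1) R(3) by (metis dvd_triv_left)
      ultimately have "card R div card ?I = 1" using prime_power_dvd_cases[OF q] by blast
      then have "card ?I = card R" using ir(1) by simp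
      then have "?I = R" using subgroup_finite[OF R(1)] by (intro card_subset_eq) auto
      then show False using \<open>?I \<noteq> R\<close> by blast
    qed
    then obtain e where e: "card R = q * e * card ?I" using ir(1) by (metis dvdE)
    have "card (dc x) * card ?I = (q * card P * e) * card ?I"
      using double_coset_card[OF s(1) R(1) xc] e unfolding dc_def by (simp add: algebra_simps)
    then show ?thesis using subgroup_card_pos[OF I] by simp
  qed
  have mem: "x \<in> dc x" if "x \<in> L" for x
  proof -
    have "x = \<one> \<otimes> x \<otimes> \<one>" using that c by auto
    then show ?thesis unfolding dc_def using subgroup.one_closed s(1) R(1) by blast
  qed
  have sub: "dc x \<subseteq> L" if "x \<in> L" for x
    unfolding dc_def using that s R by (auto intro!: subgroup.m_closed[OF s(2)])
  have eq: "dc y \<subseteq> dc x" if xy: "x \<in> L" "y \<in> dc x" for x y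
  proof
    fix z assume "z \<in> dc y"
    then obtain a b where z: "a \<in> P" "b \<in> R" "z = a \<otimes> y \<otimes> b" unfolding dc_def by blast
    obtain u v where y: "u \<in> P" "v \<in> R" "y = u \<otimes> x \<otimes> v" using xy unfolding dc_def by blast
    have m: "a \<in> carrier G" "b \<in> carrier G" "u \<in> carrier G" "v \<in> carrier G" "x \<in> carrier G"
      using z y xy c by auto
    have "z = (a \<otimes> u) \<otimes> x \<otimes> (v \<otimes> b)" using z(3) y(3) m by (simp add: grp)
    then show "z \<in> dc x" unfolding dc_def
      using subgroup.m_closed[OF s(1) z(1) y(1)] subgroup.m_closed[OF R(1) y(2) z(2)] by blast
  qed
  have sym: "x \<in> dc y" if xy: "x \<in> L" "y \<in> dc x" for x y
  proof -
    obtain u v where y: "u \<in> P" "v \<in> R" "y = u \<otimes> x \<otimes> v" using xy unfolding dc_def by blast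
    have m: "u \<in> carrier G" "v \<in> carrier G" "x \<in> carrier G" using y xy c by auto
    have "x = inv u \<otimes> y \<otimes> inv v" using y(3) m by (simp add: grp)
    then show ?thesis unfolding dc_def
      using subgroup.m_inv_closed[OF s(1) y(1)] subgroup.m_inv_closed[OF R(1) y(2)] by blast
  qed
  have "q * card P dvd card (\<Union> (dc ` L))"
  proof (rule dvd_partition)
    show "finite (\<Union> (dc ` L))" using sub subgroup_finite[OF s(2)] by (meson UN_least finite_subset)
    show "\<forall>c\<in>dc ` L. q * card P dvd card c" using d by blast
    show "\<forall>c1\<in>dc ` L. \<forall>c2\<in>dc ` L. c1 \<noteq> c2 \<longrightarrow> c1 \<inter> c2 = {}"
    proof clarify
      fix x y assume xy: "x \<in> L" "y \<in> L" "dc x \<noteq> dc y"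
      show "dc x \<inter> dc y = {}"
      proof (rule ccontr)
        assume "dc x \<inter> dc y \<noteq> {}"
        then obtain z where z: "z \<in> dc x" "z \<in> dc y" by blast
        then have zL: "z \<in> L" using sub xy by blast
        have "dc x = dc z" "dc y = dc z" using eq[OF xy(1) z(1)] eq[OF xy(2) z(2)]
            eq[OF zL sym[OF xy(1) z(1)]] eq[OF zL sym[OF xy(2) z(2)]] by auto
        then show False using xy by simp
      qed
    qed
  qed
  moreover have "\<Union> (dc ` L) = L" using mem sub by blast
  ultimately have "q * card P dvd card L div card P * card P" using card_div(1)[OF s(1,2,3)] by simp
  then show False using s(5) subgroup_card_pos[OF s(1)] by simp
qed

lemma sylow_exists:
  assumes q: "Factorial_Ring.prime q" and L: "subgroup L G"
  shows "\<exists>Q. sylow_in q Q L \<and> card Q = q ^ multiplicity q (card L)"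
proof -
  have "card L \<noteq> 0" using subgroup_card_pos[OF L] by simp
  moreover have "\<not> is_unit q" using q not_prime_unit by blast
  ultimately obtain a m where a: "a = multiplicity q (card L)" and m: "card L = q ^ a * m" "\<not> q dvd m"
    using multiplicity_decompose' by metis
  interpret L: group "G\<lparr>carrier := L\<rparr>" using L by (rule subgroup_imp_group)
  obtain Q where Q: "subgroup Q (G\<lparr>carrier := L\<rparr>)" "card Q = q ^ a"
    using sylow_thm[OF q L.group_axioms, of a m] m subgroup_finite[OF L] by (auto simp: order_def)
  have "subgroup Q G" using Q(1) L incl_subgroup by blast
  moreover have "Q \<subseteq> L" using subgroup.subset[OF Q(1)] by simp
  moreover have "card L div card Q = m" using m(1) Q(2) \<open>card L \<noteq> 0\<close> by simp
  ultimately show ?thesis unfolding sylow_in_def using L Q(2) m(2) a by blast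
qed

lemma sylow_card:
  assumes q: "Factorial_Ring.prime q" and P: "sylow_in q P L"
  shows "card P = q ^ multiplicity q (card L)"
proof -
  note s = sylow_inD[OF P]
  obtain k where k: "card P = q ^ k" using s by blast
  have e: "card L = q ^ k * (card L div card P)" using card_div(1)[OF s(1,2,3)] k by (metis mult.commute)
  have "multiplicity q (card L) = k"
  proof (rule multiplicity_eqI)
    show "q ^ k dvd card L" using e by (metis dvd_triv_left)
    show "\<not> q ^ Suc k dvd card L"
    proof
      assume "q ^ Suc k dvd card L"
      then have "q ^ k * q dvd q ^ k * (card L div card P)" using e by (simp add: mult.commute)
      then show False using s(5) q by (simp add: prime_gt_0_nat)
    qed
  qed
  then show ?thesis using k by simp
qed

lemma sylow_cj:
  assumes "sylow_in q P L" "g \<in> carrier G" "conj_set g P \<subseteq> L"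
  shows "sylow_in q (conj_set g P) L"
  using assms unfolding sylow_in_def by (auto simp: conj_set_subgroup subgroup_carr)

lemma sylow_conj_eq:
  assumes q: "Factorial_Ring.prime q" and P: "sylow_in q P L" and R: "sylow_in q R L"
  shows "\<exists>g\<in>L. R = conj_set g P"
proof -
  note s = sylow_inD[OF P] and r = sylow_inD[OF R]
  obtain g where g: "g \<in> L" "R \<subseteq> conj_set g P" using sylow_conj[OF q P r(1,3)] r(4) by blast
  have gc: "g \<in> carrier G" using g subgroup_carr[OF s(2)] by blast
  have "card R = card (conj_set g P)" using sylow_card[OF q P] sylow_card[OF q R] gc subgroup_carr[OF s(1)] by simp
  then have "R = conj_set g P"
    using g gc s(1) by (intro card_subset_eq) (auto intro: subgroup_finite conj_set_subgroup)
  then show ?thesis using g by blast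
qed

text \<open>The index of \<open>N\<close> in \<open>N <#> R\<close> equals that of
  \<open>N \<inter> R\<close> in \<open>R\<close>, a power of \<open>q\<close>. It also divides the
  index of \<open>N\<close> in \<open>M\<close>, which \<open>q\<close> does not divide, so it is
  1.\<close>

lemma normal_contains_p_subgroup:
  assumes q: "Factorial_Ring.prime q" and N: "normal_in N M" "\<not> q dvd card M div card N"
    and R: "subgroup R G" "R \<subseteq> M" "card R = q ^ k"
  shows "R \<subseteq> N"
proof -
  note n = normal_inD[OF N(1)]
  have sg: "subgroup (N <#> R) G" by (rule set_mult_subgroup) (use n R in auto)
  have "N <#> R \<subseteq> M" by (rule set_mult_least) (use n R in auto)
  then have "card M div card N = (card M div card (N <#> R)) * (card (N <#> R) div card N)"
    using card_div_mult[OF n(1) sg n(2) set_mult_ub(1)] n R by blast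
  then have "\<not> q dvd card (N <#> R) div card N" using N(2) by (metis dvd_mult)
  moreover have e: "card (N <#> R) div card N = card R div card (N \<inter> R)"
    using card_set_mult_div[OF n(1) R(1) sg] .
  moreover have "card R div card (N \<inter> R) dvd q ^ k"
    using card_div(1)[OF subgroup_Int[OF n(1) R(1)] R(1)] R(3) by (metis dvd_triv_left inf_le2)
  ultimately have "card R div card (N \<inter> R) = 1" using prime_power_dvd_cases[OF q] by metis
  then have "card (N \<inter> R) = card R" using card_div(1)[OF subgroup_Int[OF n(1) R(1)] R(1)] by simp
  then have "N \<inter> R = R" using subgroup_finite[OF R(1)] by (intro card_subset_eq) auto
  then show ?thesis by blast
qed

text \<open>The Frattini argument: the conjugate of \<open>Q\<close> by any \<open>g\<close> is
  again Sylow in \<open>L\<close>, hence also a conjugate by some \<open>l\<close> in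
  \<open>L\<close>, and \<open>inv l \<otimes> g\<close> normalizes \<open>Q\<close>.\<close>

lemma frattini:
  assumes q: "Factorial_Ring.prime q" and L: "normal_in L (carrier G)" and Q: "sylow_in q Q L"
  shows "L <#> normaliser Q = carrier G"
proof
  note s = sylow_inD[OF Q]
  note c = subgroup_carr[OF s(1)] subgroup_carr[OF s(2)]
  show "L <#> normaliser Q \<subseteq> carrier G" using c by (intro set_mult_closed) (auto simp: normaliser_def)
  show "carrier G \<subseteq> L <#> normaliser Q"
  proof
    fix g assume g: "g \<in> carrier G"
    have "conj_set g Q \<subseteq> L" using conj_set_mono[OF s(3)] normal_inD(6)[OF L g] by blast
    from sylow_conj_eq[OF q Q sylow_cj[OF Q g this]]
    obtain l where l: "l \<in> L" "conj_set g Q = conj_set l Q" by blast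
    have lc: "l \<in> carrier G" using l c by blast
    have "conj_set (inv l \<otimes> g) Q = conj_set (inv l) (conj_set g Q)" using lc g c by (simp add: conj_set_comp)
    also have "\<dots> = Q" using l lc c by simp
    finally have "inv l \<otimes> g \<in> normaliser Q" unfolding normaliser_def using lc g by simp
    moreover have "g = l \<otimes> (inv l \<otimes> g)" using lc g by simp
    ultimately show "g \<in> L <#> normaliser Q" unfolding set_mult_mem using l by blast
  qed
qed

text \<open>\<open>Q\<close> is still Sylow in the normal subgroup \<open>L \<inter> K\<close>, and
  the Frattini argument applied there stays inside \<open>K\<close>. This is what shows that a
  proper subgroup above such a normalizer is not normal.\<close>

lemma frattini_normal:
  assumes q: "Factorial_Ring.prime q" and L: "normal_in L (carrier G)" and Q: "sylow_in q Q L"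
    and K: "normal_in K (carrier G)" "normaliser Q \<subseteq> K"
  shows "K = carrier G"
proof -
  note s = sylow_inD[OF Q] and k = normal_inD[OF K(1)]
  have Qn: "Q \<subseteq> L \<inter> K" using s K normaliser_self by blast
  have LK: "subgroup (L \<inter> K) G" using s k subgroup_Int by blast
  have "card L div card Q = (card L div card (L \<inter> K)) * (card (L \<inter> K) div card Q)"
    using card_div_mult[OF s(1) LK s(2) Qn] by blast
  then have "sylow_in q Q (L \<inter> K)"
    using s Qn LK unfolding sylow_in_def by (metis dvd_mult)
  then have "(L \<inter> K) <#> normaliser Q = carrier G" using frattini[OF q normal_in_Int[OF L K(1)]] by blast
  moreover have "(L \<inter> K) <#> normaliser Q \<subseteq> K" by (rule set_mult_least) (use k K in auto)
  ultimately show ?thesis using k by blast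
qed

subsection \<open>Nilpotent subgroups\<close>

text \<open>Only this hereditary consequence of nilpotency is used: it gives both the normalizer condition
  (conjugation by \<open>g\<close> preserves \<open>Y\<close>) and, for normal \<open>Y\<close>, a nontrivial centre modulo \<open>Y\<close>.\<close>
definition nilpotent_in :: "'a set \<Rightarrow> bool" where
  "nilpotent_in K \<longleftrightarrow> subgroup K G \<and>
    (\<forall>J Y. subgroup J G \<and> J \<subseteq> K \<and> subgroup Y G \<and> Y \<subset> J \<longrightarrow>
      (\<exists>g\<in>J - Y. \<forall>y\<in>J. g \<otimes> y \<otimes> inv g \<otimes> inv y \<in> Y))"

text \<open>Let \<open>n\<close> be the first index at which the lower central series of
  \<open>K\<close>, intersected with \<open>J\<close>, falls inside \<open>Y\<close>. An element of
  the previous term that lies in \<open>J\<close> but not in \<open>Y\<close> has its commutators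
  with \<open>J\<close> in term \<open>n\<close>, hence in \<open>Y\<close>.\<close>

lemma nilpotent_imp_nilp:
  assumes "nilpotent_group (G\<lparr>carrier := K\<rparr>)" and K: "subgroup K G"
  shows "nilpotent_in K"
proof -
  let ?K = "G\<lparr>carrier := K\<rparr>"
  interpret K: group ?K using K by (rule subgroup_imp_group)
  let ?c = "lower_central ?K"
  let ?S = "\<lambda>n. {x \<otimes>\<^bsub>?K\<^esub> y \<otimes>\<^bsub>?K\<^esub> inv\<^bsub>?K\<^esub> x \<otimes>\<^bsub>?K\<^esub> inv\<^bsub>?K\<^esub> y | x y. x \<in> ?c n \<and> y \<in> carrier ?K}"
  obtain N where N: "?c N = {\<one>}" using assms(1) unfolding nilpotent_group_def by auto
  have sub: "?c n \<subseteq> K" for n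
  proof (induction n)
    case (Suc n)
    have "?S n \<subseteq> carrier ?K"
      using Suc by (auto intro!: subgroup.m_closed[OF K] K.inv_closed[simplified])
    then have "generate ?K (?S n) \<subseteq> carrier ?K" by (rule K.generate_incl)
    then show ?case by simp
  qed simp
  have comm: "x \<otimes> y \<otimes> inv x \<otimes> inv y \<in> ?c (Suc n)" if "x \<in> ?c n" "y \<in> K" for x y n
  proof -
    have "inv\<^bsub>?K\<^esub> x = inv x" "inv\<^bsub>?K\<^esub> y = inv y"
      using that sub K m_inv_consistent by blast+
    then have e: "x \<otimes>\<^bsub>?K\<^esub> y \<otimes>\<^bsub>?K\<^esub> inv\<^bsub>?K\<^esub> x \<otimes>\<^bsub>?K\<^esub> inv\<^bsub>?K\<^esub> y = x \<otimes> y \<otimes> inv x \<otimes> inv y"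
      by simp
    have "x \<otimes>\<^bsub>?K\<^esub> y \<otimes>\<^bsub>?K\<^esub> inv\<^bsub>?K\<^esub> x \<otimes>\<^bsub>?K\<^esub> inv\<^bsub>?K\<^esub> y \<in> generate ?K (?S n)"
      by (rule generate.incl, intro CollectI exI conjI refl) (use that in simp_all)
    then show ?thesis unfolding e lower_central.simps .
  qed
  have "\<exists>g\<in>J - Y. \<forall>y\<in>J. g \<otimes> y \<otimes> inv g \<otimes> inv y \<in> Y"
    if J: "subgroup J G" "J \<subseteq> K" and Y: "subgroup Y G" "Y \<subset> J" for J Y
  proof -
    define n where "n = (LEAST n. ?c n \<inter> J \<subseteq> Y)"
    have "?c N \<inter> J \<subseteq> Y" using N subgroup.one_closed[OF Y(1)] by auto
    then have n: "?c n \<inter> J \<subseteq> Y" unfolding n_def by (rule LeastI)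
    \<comment> \<open>The series starts at \<open>K\<close>, which contains \<open>J\<close>, so
      \<open>n\<close> has a predecessor.\<close>
    have "\<not> ?c 0 \<inter> J \<subseteq> Y" using J Y by auto
    then have "n \<noteq> 0" using n by metis
    then obtain m where m: "n = Suc m" using not0_implies_Suc by blast
    have "m < n" using m by simp
    then have "\<not> ?c m \<inter> J \<subseteq> Y" unfolding n_def by (rule not_less_Least)
    then obtain g where g: "g \<in> ?c m" "g \<in> J" "g \<notin> Y" by blast
    have "g \<otimes> y \<otimes> inv g \<otimes> inv y \<in> Y" if y: "y \<in> J" for y
    proof -
      have "g \<otimes> y \<otimes> inv g \<otimes> inv y \<in> ?c n" using comm[OF g(1)] y J(2) m by blast
      moreover have "g \<otimes> y \<otimes> inv g \<otimes> inv y \<in> J"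
        using g y J(1) by (intro subgroup.m_closed subgroup.m_inv_closed)
      ultimately show ?thesis using n by blast
    qed
    then show ?thesis using g by blast
  qed
  then show ?thesis unfolding nilpotent_in_def using K by blast
qed

lemma nilpD:
  assumes "nilpotent_in K"
  shows "subgroup K G"
    "\<And>Y. subgroup Y G \<Longrightarrow> Y \<subset> K \<Longrightarrow> \<exists>g\<in>K - Y. \<forall>y\<in>K. g \<otimes> y \<otimes> inv g \<otimes> inv y \<in> Y"
  using assms unfolding nilpotent_in_def by auto

lemma nilpotent_in_mono: "\<lbrakk>nilpotent_in K; subgroup J G; J \<subseteq> K\<rbrakk> \<Longrightarrow> nilpotent_in J"
  unfolding nilpotent_in_def by (meson order_trans)

lemma conj_eq_comm: "\<lbrakk>g \<in> carrier G; y \<in> carrier G\<rbrakk> \<Longrightarrow> g \<otimes> y \<otimes> inv g = (g \<otimes> y \<otimes> inv g \<otimes> inv y) \<otimes> y"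
  by (simp add: grp)

text \<open>The normalizer condition: if the commutators of \<open>g\<close> with \<open>K\<close>
  lie in \<open>Y\<close>, then the conjugate by \<open>g\<close> of an element \<open>y\<close> of
  \<open>Y\<close> is such a commutator times \<open>y\<close>, again in \<open>Y\<close>.\<close>

lemma nilpotent_in_normalizer:
  assumes K: "nilpotent_in K" and Y: "subgroup Y G" "Y \<subset> K"
  shows "\<exists>g\<in>K - Y. g \<in> normaliser Y"
proof -
  obtain g where g: "g \<in> K - Y" "\<forall>y\<in>K. g \<otimes> y \<otimes> inv g \<otimes> inv y \<in> Y" using nilpD(2)[OF K Y] by blast
  note c = subgroup_carr[OF Y(1)] subgroup_carr[OF nilpD(1)[OF K]]
  have "g \<otimes> y \<otimes> inv g \<in> Y" if "y \<in> Y" for y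
    using conj_eq_comm[of g y] g that c Y subgroup.m_closed[OF Y(1), of "g \<otimes> y \<otimes> inv g \<otimes> inv y" y]
    by (metis (no_types, lifting) DiffD1 psubsetD subsetD)
  then have "g \<in> normaliser Y" using normaliser_iff[OF c(1)] g c by auto
  then show ?thesis using g by blast
qed

lemma nilpotent_in_cj:
  assumes K: "nilpotent_in K" and g: "g \<in> carrier G"
  shows "nilpotent_in (conj_set g K)"
  unfolding nilpotent_in_def
proof (intro conjI allI impI)
  note Ks = nilpD(1)[OF K]
  show "subgroup (conj_set g K) G" using conj_set_subgroup g Ks .
  fix J Y assume a: "subgroup J G \<and> J \<subseteq> conj_set g K \<and> subgroup Y G \<and> Y \<subset> J"
  let ?J = "conj_set (inv g) J" and ?Y = "conj_set (inv g) Y"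
  have c: "J \<subseteq> carrier G" "Y \<subseteq> carrier G" "K \<subseteq> carrier G" using a Ks subgroup_carr by auto
  have J: "subgroup ?J G" "subgroup ?Y G" using a g conj_set_subgroup by auto
  have "?J \<subseteq> K" using a g c conj_set_mono[of J "conj_set g K" "inv g"] by simp
  moreover have "?Y \<subset> ?J" using a g c conj_set_mono[of Y J "inv g"] conj_set_inv(2)[of g] by (metis psubsetE psubsetI)
  ultimately obtain h where h: "h \<in> ?J - ?Y" "\<forall>y\<in>?J. h \<otimes> y \<otimes> inv h \<otimes> inv y \<in> ?Y"
    using K J unfolding nilpotent_in_def by meson
  have hc: "h \<in> carrier G" using h J subgroup_carr by blast
  let ?h = "g \<otimes> h \<otimes> inv g"
  have "?h \<in> J - Y"
  proof -
    have "h = inv g \<otimes> ?h \<otimes> inv (inv g)" "?h \<in> carrier G" using g hc by (simp_all add: grp)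
    then show ?thesis using h conj_set_mem[of "inv g" J h] conj_set_mem[of "inv g" Y h] g hc c by simp
  qed
  moreover have "?h \<otimes> y \<otimes> inv ?h \<otimes> inv y \<in> Y" if y: "y \<in> J" for y
  proof -
    let ?y = "inv g \<otimes> y \<otimes> g"
    have yc: "y \<in> carrier G" using y c by blast
    have "?y \<in> ?J" using conj_set_mem[of "inv g" J ?y] y yc g c by (simp add: grp)
    then have "h \<otimes> ?y \<otimes> inv h \<otimes> inv ?y \<in> ?Y" using h by blast
    then have "g \<otimes> (h \<otimes> ?y \<otimes> inv h \<otimes> inv ?y) \<otimes> inv g \<in> Y"
      using conj_set_mem[of "inv g" Y "h \<otimes> ?y \<otimes> inv h \<otimes> inv ?y"] g hc yc c by simp
    then show ?thesis using g hc yc by (simp add: grp)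
  qed
  ultimately show "\<exists>g\<in>J - Y. \<forall>y\<in>J. g \<otimes> y \<otimes> inv g \<otimes> inv y \<in> Y" by blast
qed

text \<open>\<open>R\<close> contains every \<open>q\<close>-subgroup of \<open>?N\<close>, its
  normalizer in \<open>K\<close>. So an element normalizing \<open>?N\<close> normalizes
  \<open>R\<close>, and the normalizer condition forces \<open>?N = K\<close>.\<close>

lemma nilpotent_in_sylow_normal:
  assumes q: "Factorial_Ring.prime q" and K: "nilpotent_in K" and R: "sylow_in q R K"
  shows "normal_in R K"
proof -
  note r = sylow_inD[OF R] and Ks = nilpD(1)[OF K]
  note c = subgroup_carr[OF r(1)] subgroup_carr[OF Ks]
  let ?N = "normaliser R \<inter> K"
  have N: "subgroup ?N G" using normaliser_subgroup[OF c(1)] Ks subgroup_Int by blast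
  have RN: "R \<subseteq> ?N" using normaliser_self[OF r(1)] r(3) by blast
  have nR: "normal_in R ?N" using r(1) N RN unfolding normal_in_iff by blast
  have "card K div card R = (card K div card ?N) * (card ?N div card R)"
    using card_div_mult[OF r(1) N Ks RN] by blast
  then have nd: "\<not> q dvd card ?N div card R" using r(5) by (metis dvd_mult)
  have "?N = K"
  proof (rule ccontr)
    assume "?N \<noteq> K"
    then have "?N \<subset> K" by blast
    then obtain g where g: "g \<in> K - ?N" "g \<in> normaliser ?N" using nilpotent_in_normalizer[OF K N] by blast
    have gc: "g \<in> carrier G" using g c by blast
    have "conj_set g R \<subseteq> ?N" using conj_set_mono[OF RN, of g] g(2) unfolding normaliser_def by auto
    moreover obtain k where "card R = q ^ k" using r(4) by blast
    ultimately have "conj_set g R \<subseteq> R"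
      using normal_contains_p_subgroup[OF q nR nd conj_set_subgroup[OF gc r(1)], of k] gc c by simp
    then have "g \<in> normaliser R" using conj_set_eqI[OF gc c(1)] gc unfolding normaliser_def by simp
    then show False using g by blast
  qed
  then show ?thesis using nR by simp
qed

section \<open>Commuting normal subgroups and normal complements\<close>

lemma commute_trivial_Int:
  assumes A: "normal_in A M" and B: "normal_in B M" and "A \<inter> B = {\<one>}" and a: "a \<in> A" and b: "b \<in> B"
  shows "a \<otimes> b = b \<otimes> a"
proof -
  note n = normal_inD[OF A] and m = normal_inD[OF B]
  have c: "a \<in> carrier G" "b \<in> carrier G" using a b subgroup_carr[OF n(1)] subgroup_carr[OF m(1)] by auto
  have ab: "a \<in> M" "b \<in> M" using a b n(3) m(3) by auto
  \<comment> \<open>The commutator of \<open>a\<close> and \<open>b\<close>, bracketed in two ways,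
    lies in \<open>B\<close> and in \<open>A\<close>.\<close>
  have "(a \<otimes> b \<otimes> inv a) \<otimes> inv b \<in> B"
    by (rule subgroup.m_closed[OF m(1) m(4)[OF ab(1) b] subgroup.m_inv_closed[OF m(1) b]])
  moreover have "a \<otimes> (b \<otimes> inv a \<otimes> inv b) \<in> A"
    by (rule subgroup.m_closed[OF n(1) a n(4)[OF ab(2) subgroup.m_inv_closed[OF n(1) a]]])
  moreover have "a \<otimes> (b \<otimes> inv a \<otimes> inv b) = (a \<otimes> b \<otimes> inv a) \<otimes> inv b" using c by (simp add: grp)
  ultimately have "(a \<otimes> b \<otimes> inv a) \<otimes> inv b = \<one>" using assms(3) by auto
  then have "(a \<otimes> b \<otimes> inv a) \<otimes> inv b \<otimes> (b \<otimes> a) = b \<otimes> a" using c by simp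
  then show ?thesis using c by (simp add: grp)
qed

lemma coprime_Int_trivial:
  assumes "subgroup A G" "subgroup B G" "coprime (card A) (card B)"
  shows "A \<inter> B = {\<one>}"
proof -
  have I: "subgroup (A \<inter> B) G" using subgroup_Int assms by blast
  have "card (A \<inter> B) dvd card A" "card (A \<inter> B) dvd card B" using subgroup_card_dvd[OF I] assms by auto
  then have "card (A \<inter> B) = 1" using assms(3) coprime_common_divisor_nat by blast
  moreover have "\<one> \<in> A \<inter> B" using I subgroup.one_closed by blast
  ultimately show ?thesis by (metis card_1_singletonE singletonD)
qed

lemma normal_in_set_mult:
  assumes A: "normal_in A M" and B: "normal_in B M"
  shows "normal_in (A <#> B) M"
proof -
  note n = normal_inD[OF A] and m = normal_inD[OF B]
  have "subgroup (A <#> B) G" by (rule set_mult_subgroup) (use n m in auto)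
  moreover have "A <#> B \<subseteq> M" by (rule set_mult_least) (use n m in auto)
  moreover have "g \<otimes> x \<otimes> inv g \<in> A <#> B" if g: "g \<in> M" and x: "x \<in> A <#> B" for g x
  proof -
    obtain a b where ab: "a \<in> A" "b \<in> B" "x = a \<otimes> b" using x unfolding set_mult_mem by blast
    have "g \<in> carrier G" "a \<in> carrier G" "b \<in> carrier G"
      using g ab subgroup_carr[OF n(1)] subgroup_carr[OF m(1)] subgroup_carr[OF n(2)] by auto
    then have "g \<otimes> x \<otimes> inv g = (g \<otimes> a \<otimes> inv g) \<otimes> (g \<otimes> b \<otimes> inv g)" using ab(3) by (simp add: grp)
    then show ?thesis unfolding set_mult_mem using n(4)[OF g ab(1)] m(4)[OF g ab(2)] by blast
  qed
  ultimately show ?thesis unfolding normal_in_def using n by blast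
qed

lemma only_prime_divisor_power:
  fixes n r :: nat
  assumes "Factorial_Ring.prime r" "0 < n" "\<And>s. Factorial_Ring.prime s \<Longrightarrow> s \<noteq> r \<Longrightarrow> \<not> s dvd n"
  shows "\<exists>k. n = r ^ k"
proof -
  have "\<not> is_unit r" using assms(1) not_prime_unit by blast
  moreover have "n \<noteq> 0" using assms(2) by simp
  ultimately obtain m where m: "n = r ^ multiplicity r n * m" "\<not> r dvd m" using multiplicity_decompose' by blast
  have "m = 1"
  proof (rule ccontr)
    assume "m \<noteq> 1"
    then obtain s where "Factorial_Ring.prime s" "s dvd m" using prime_factor_nat by blast
    then show False using assms(3)[of s] m by (metis dvd_mult)
  qed
  then show ?thesis using m by (metis mult.right_neutral)
qed

lemma ex_max_card:
  assumes "P A" "\<And>H. P H \<Longrightarrow> H \<subseteq> carrier G"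
  shows "\<exists>H. P H \<and> (\<forall>J. P J \<longrightarrow> card J \<le> card H)"
proof -
  have "\<forall>H. P H \<longrightarrow> card H < Suc (card (carrier G))"
    using assms(2) fin by (auto simp: less_Suc_eq_le intro: card_mono)
  then show ?thesis using ex_has_greatest_nat[of P A card] assms(1) by blast
qed

text \<open>Builds a normal complement one prime at a time. Choose \<open>H\<close> of greatest
  order among the normal subgroups of \<open>M\<close> of order prime to \<open>r\<close>.
  Multiplying \<open>H\<close> by the \<open>N\<close> given for \<open>s\<close> keeps both
  properties, so \<open>N\<close> lies in \<open>H\<close> and \<open>s\<close> does not divide the
  index of \<open>H\<close>.\<close>

lemma normal_complementI:
  assumes r: "Factorial_Ring.prime r" and M: "subgroup M G"
    and N: "\<And>s. Factorial_Ring.prime s \<Longrightarrow> s \<noteq> r \<Longrightarrow>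
      \<exists>N. normal_in N M \<and> coprime (card N) r \<and> \<not> s dvd card M div card N"
  shows "\<exists>H k. normal_in H M \<and> coprime (card H) r \<and> card M = r ^ k * card H"
proof -
  let ?P = "\<lambda>H. normal_in H M \<and> coprime (card H) r"
  have "?P {\<one>}" using M subgroup.one_closed subgroup_carr[OF M] triv_subgroup unfolding normal_in_def by auto
  moreover have "H \<subseteq> carrier G" if "?P H" for H using that normal_inD(1) subgroup_carr by blast
  ultimately obtain H where H: "?P H" "\<And>J. ?P J \<Longrightarrow> card J \<le> card H"
    using ex_max_card[of ?P "{\<one>}"] by blast
  note h = normal_inD[OF H(1)[THEN conjunct1]]
  have "\<not> s dvd card M div card H" if s: "Factorial_Ring.prime s" "s \<noteq> r" for s
  proof -
    obtain N where N': "normal_in N M" "coprime (card N) r" "\<not> s dvd card M div card N" using N[OF s] by blast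
    note n = normal_inD[OF N'(1)]
    have HN: "normal_in (H <#> N) M" using normal_in_set_mult H(1) N'(1) by blast
    have "coprime (card H * card N) r" using H(1) N'(2) by simp
    then have "coprime (card (H <#> N)) r"
      by (rule coprime_divisors[OF card_set_mult_dvd[OF h(1) n(1)] dvd_refl])
    then have "card (H <#> N) \<le> card H" using H(2) HN by blast
    then have "H = H <#> N"
      using set_mult_ub(1)[OF h(1) n(1)] subgroup_finite[OF normal_inD(1)[OF HN]] by (intro card_seteq)
    then have NH: "N \<subseteq> H" using set_mult_ub(2)[OF h(1) n(1)] by simp
    have "card M div card N = (card M div card H) * (card H div card N)"
      using card_div_mult[OF n(1) h(1) M NH h(3)] .
    then show ?thesis using N'(3) by (metis dvd_mult2)
  qed
  with only_prime_divisor_power[OF r card_div(2)[OF h(1) M h(3)]]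
  have "\<exists>k. card M div card H = r ^ k" .
  then obtain k where k: "card M div card H = r ^ k" ..
  have "card M = r ^ k * card H" using card_div(1)[OF h(1) M h(3)] unfolding k .
  then show ?thesis using H(1) by blast
qed

text \<open>For each prime other than \<open>r\<close>, a Sylow subgroup of \<open>K\<close> is
  normal and serves as the \<open>N\<close> of \<open>normal_complementI\<close>.\<close>

lemma nilpotent_in_complement:
  assumes K: "nilpotent_in K" and r: "Factorial_Ring.prime r"
  shows "\<exists>H k. normal_in H K \<and> coprime (card H) r \<and> card K = r ^ k * card H"
proof (rule normal_complementI[OF r nilpD(1)[OF K]])
  fix s assume s: "Factorial_Ring.prime s" "s \<noteq> r"
  obtain R where R: "sylow_in s R K" using sylow_exists[OF s(1) nilpD(1)[OF K]] by blast
  then obtain k where "card R = s ^ k" using sylow_inD(4) by blast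
  then have "coprime (card R) r" using primes_coprime[OF s(1) r s(2)] by simp
  then show "\<exists>N. normal_in N K \<and> coprime (card N) r \<and> \<not> s dvd card K div card N"
    using nilpotent_in_sylow_normal[OF s(1) K R] sylow_inD(5)[OF R] by blast
qed

lemma maximal_subgroup_exists:
  assumes A: "subgroup A G" "A \<noteq> carrier G"
  shows "\<exists>K. maximal_subgroup G K \<and> A \<subseteq> K"
proof -
  let ?P = "\<lambda>K. subgroup K G \<and> A \<subseteq> K \<and> K \<noteq> carrier G"
  have "?P A" using A by simp
  moreover have "H \<subseteq> carrier G" if "?P H" for H using that subgroup_carr by blast
  ultimately have "\<exists>K. ?P K \<and> (\<forall>J. ?P J \<longrightarrow> card J \<le> card K)" by (rule ex_max_card[of ?P A])
  then obtain K where K: "?P K" "\<And>J. ?P J \<Longrightarrow> card J \<le> card K" by metis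
  have "J = K \<or> J = carrier G" if J: "subgroup J G" "K \<subseteq> J" for J
  proof (rule disjCI)
    assume "J \<noteq> carrier G"
    then have "card J \<le> card K" using K(1) J by (intro K(2)) blast
    then show "J = K" using J card_seteq[OF subgroup_finite[OF J(1)] J(2)] by simp
  qed
  then have "maximal_subgroup G K" using K(1) unfolding maximal_subgroup_def by simp
  then show ?thesis using K(1) by blast
qed

subsection \<open>Transfer\<close>

lemma rcosets_mem:
  assumes M: "subgroup M G" and c: "c \<in> rcosets M"
  shows "c \<subseteq> carrier G" "\<And>y. y \<in> c \<Longrightarrow> c = M #> y" "c \<noteq> {}"
proof -
  obtain x where x: "x \<in> carrier G" "c = M #> x" using c unfolding RCOSETS_def by blast
  show 1: "c \<subseteq> carrier G" using x r_coset_subset_G[OF subgroup_carr[OF M]] by simp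
  show "\<And>y. y \<in> c \<Longrightarrow> c = M #> y" using x repr_independence[OF _ x(1) M] by simp
  show "c \<noteq> {}" using rcos_self[OF x(1) M] x by blast
qed

lemma rcosets_translate:
  assumes M: "subgroup M G" and c: "c \<in> rcosets M" and g: "g \<in> carrier G"
  shows "c #> g \<in> rcosets M"
proof -
  obtain x where x: "x \<in> carrier G" "c = M #> x" using c unfolding RCOSETS_def by blast
  then have "c #> g = M #> (x \<otimes> g)" using g subgroup_carr[OF M] by (simp add: coset_mult_assoc)
  then show ?thesis using x g unfolding RCOSETS_def by blast
qed

lemma rcosets_translate_bij:
  assumes M: "subgroup M G" and g: "g \<in> carrier G"
  shows "inj_on (\<lambda>c. c #> g) (rcosets M)" "(\<lambda>c. c #> g) ` (rcosets M) = rcosets M"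
proof -
  have inv: "c #> g #> inv g = c" "c #> inv g #> g = c" if "c \<in> rcosets M" for c
    using rcosets_mem(1)[OF M that] g by (simp_all add: coset_mult_assoc)
  show "inj_on (\<lambda>c. c #> g) (rcosets M)" by (rule inj_on_inverseI) (rule inv(1))
  show "(\<lambda>c. c #> g) ` (rcosets M) = rcosets M"
  proof (intro equalityI subsetI)
    fix c assume "c \<in> (\<lambda>c. c #> g) ` (rcosets M)"
    then show "c \<in> rcosets M" using rcosets_translate[OF M _ g] by blast
  next
    fix c assume c: "c \<in> rcosets M"
    have "c = (c #> inv g) #> g" using inv(2)[OF c] by simp
    moreover have "c #> inv g \<in> rcosets M" using rcosets_translate[OF M c] g by simp
    ultimately show "c \<in> (\<lambda>c. c #> g) ` (rcosets M)" by (rule image_eqI)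
  qed
qed

text \<open>These elements are the factors of the transfer. They lie in \<open>M\<close> because
  \<open>t c \<otimes> g\<close> and \<open>t (c #> g)\<close> represent the same right
  coset.\<close>

lemma transversal_term:
  assumes M: "subgroup M G" and t: "\<forall>c\<in>rcosets M. t c \<in> c"
    and c: "c \<in> rcosets M" and g: "g \<in> carrier G"
  shows "t c \<otimes> g \<otimes> inv (t (c #> g)) \<in> M" "t c \<in> carrier G" "t (c #> g) \<in> carrier G"
proof -
  note cg = rcosets_translate[OF M c g]
  show tc: "t c \<in> carrier G" "t (c #> g) \<in> carrier G"
    using bspec[OF t c] bspec[OF t cg] rcosets_mem(1)[OF M c] rcosets_mem(1)[OF M cg] by auto
  obtain y where y: "y \<in> c" "t (c #> g) = y \<otimes> g" using bspec[OF t cg] unfolding r_coset_def by blast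
  have yc: "y \<in> carrier G" using y rcosets_mem(1)[OF M c] by blast
  have "t c \<in> M #> y" using rcosets_mem(2)[OF M c y(1)] bspec[OF t c] by simp
  then obtain m where m: "m \<in> M" "t c = m \<otimes> y" unfolding r_coset_def by blast
  have "m \<in> carrier G" using m subgroup_carr[OF M] by blast
  then have "t c \<otimes> g \<otimes> inv (t (c #> g)) = m" using m(2) y(2) yc g by (simp add: grp)
  then show "t c \<otimes> g \<otimes> inv (t (c #> g)) \<in> M" using m by simp
qed

text \<open>The map is the transfer followed by \<open>f\<close>. The factor of
  \<open>g \<otimes> h\<close> at \<open>c\<close> is the factor of \<open>g\<close> at
  \<open>c\<close> times that of \<open>h\<close> at \<open>c #> g\<close>, and right translation by
  \<open>g\<close> permutes the cosets.\<close>

lemma transfer_hom: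
  assumes A: "comm_group A" and M: "subgroup M G" and f: "f \<in> hom (G\<lparr>carrier := M\<rparr>) A"
    and t: "\<forall>c\<in>rcosets M. t c \<in> c"
  shows "(\<lambda>g. finprod A (\<lambda>c. f (t c \<otimes> g \<otimes> inv (t (c #> g)))) (rcosets M)) \<in> hom G A"
proof -
  interpret A: comm_group A by (rule A)
  let ?\<tau> = "\<lambda>c g. t c \<otimes> g \<otimes> inv (t (c #> g))"
  note \<tau> = transversal_term[OF M t]
  have fM: "f x \<in> carrier A" if "x \<in> M" for x using f that unfolding hom_def by auto
  have fm: "f (x \<otimes> y) = f x \<otimes>\<^bsub>A\<^esub> f y" if "x \<in> M" "y \<in> M" for x y
    using f that unfolding hom_def by auto
  have cl: "(\<lambda>c. f (?\<tau> c g)) \<in> rcosets M \<rightarrow> carrier A" if "g \<in> carrier G" for g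
    using \<tau>(1)[OF _ that] fM by blast
  have "finprod A (\<lambda>c. f (?\<tau> c (g \<otimes> h))) (rcosets M) =
      finprod A (\<lambda>c. f (?\<tau> c g)) (rcosets M) \<otimes>\<^bsub>A\<^esub> finprod A (\<lambda>c. f (?\<tau> c h)) (rcosets M)"
    if g: "g \<in> carrier G" and h: "h \<in> carrier G" for g h
  proof -
    have split: "f (?\<tau> c (g \<otimes> h)) = f (?\<tau> c g) \<otimes>\<^bsub>A\<^esub> f (?\<tau> (c #> g) h)" if c: "c \<in> rcosets M" for c
    proof -
      have e: "c #> (g \<otimes> h) = c #> g #> h"
        using rcosets_mem(1)[OF M c] g h by (simp add: coset_mult_assoc)
      note c' = rcosets_translate[OF M c g]
      note car = \<tau>(2,3)[OF c g] \<tau>(3)[OF c' h]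
      have "?\<tau> c (g \<otimes> h) = ?\<tau> c g \<otimes> ?\<tau> (c #> g) h" unfolding e using car g h by (simp add: grp)
      then show ?thesis using fm[OF \<tau>(1)[OF c g] \<tau>(1)[OF c' h]] by simp
    qed
    have cl': "(\<lambda>c. f (?\<tau> (c #> g) h)) \<in> rcosets M \<rightarrow> carrier A"
      using cl[OF h] rcosets_translate[OF M _ g] by (simp add: Pi_iff)
    have "finprod A (\<lambda>c. f (?\<tau> c (g \<otimes> h))) (rcosets M) =
        finprod A (\<lambda>c. f (?\<tau> c g) \<otimes>\<^bsub>A\<^esub> f (?\<tau> (c #> g) h)) (rcosets M)"
      by (rule A.finprod_cong') (use split cl[OF g] cl' in \<open>simp_all add: Pi_iff\<close>)
    also have "\<dots> = finprod A (\<lambda>c. f (?\<tau> c g)) (rcosets M) \<otimes>\<^bsub>A\<^esub>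
        finprod A (\<lambda>c. f (?\<tau> (c #> g) h)) (rcosets M)"
      by (rule A.finprod_multf[OF cl[OF g] cl'])
    also have "finprod A (\<lambda>c. f (?\<tau> (c #> g) h)) (rcosets M) =
        finprod A (\<lambda>c. f (?\<tau> c h)) ((\<lambda>c. c #> g) ` (rcosets M))"
      by (rule A.finprod_reindex[symmetric])
        (use cl[OF h] rcosets_translate_bij[OF M g] in simp_all)
    finally show ?thesis unfolding rcosets_translate_bij(2)[OF M g] .
  qed
  then show ?thesis using cl unfolding hom_def by (auto intro!: A.finprod_closed)
qed

text \<open>Prepares the target of the transfer, with cosets formed in \<open>G\<close> instead of
  in the restricted structure. Commutativity holds because \<open>ab\<close> puts all commutators of
  \<open>M\<close> into \<open>B\<close>.\<close>

lemma Mod_abelian: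
  assumes B: "normal_in B M" and ab: "\<forall>x\<in>M. \<forall>y\<in>M. x \<otimes> y \<otimes> inv x \<otimes> inv y \<in> B"
  shows "comm_group ((G\<lparr>carrier := M\<rparr>) Mod B)"
    and "(\<lambda>x. B #> x) \<in> hom (G\<lparr>carrier := M\<rparr>) ((G\<lparr>carrier := M\<rparr>) Mod B)"
    and "\<And>x y. x \<in> M \<Longrightarrow> y \<in> M \<Longrightarrow> B #> x = B #> y \<longleftrightarrow> x \<otimes> inv y \<in> B"
    and "\<one>\<^bsub>(G\<lparr>carrier := M\<rparr>) Mod B\<^esub> = B"
    and "carrier ((G\<lparr>carrier := M\<rparr>) Mod B) = (\<lambda>x. B #> x) ` M"
proof -
  let ?M = "G\<lparr>carrier := M\<rparr>"
  note b = normal_inD[OF B]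
  interpret M: group ?M using b(2) by (rule subgroup_imp_group)
  have "subgroup B ?M" using b(1,2,3) subgroup_incl by blast
  moreover have "inv\<^bsub>?M\<^esub> x = inv x" if "x \<in> M" for x using that b(2) m_inv_consistent by blast
  ultimately have n: "B \<lhd> ?M" using b(4) by (auto simp: M.normal_inv_iff)
  interpret N: normal B ?M by (rule n)
  have rc: "B #>\<^bsub>?M\<^esub> x = B #> x" for x unfolding r_coset_def by simp
  have hom: "(\<lambda>x. B #> x) \<in> hom ?M (?M Mod B)" using N.r_coset_hom_Mod unfolding rc .
  then show "(\<lambda>x. B #> x) \<in> hom ?M (?M Mod B)" .
  show car: "carrier (?M Mod B) = (\<lambda>x. B #> x) ` M"
    unfolding FactGroup_def RCOSETS_def rc by auto
  show "\<one>\<^bsub>?M Mod B\<^esub> = B" by simp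
  show eq: "B #> x = B #> y \<longleftrightarrow> x \<otimes> inv y \<in> B" if "x \<in> M" "y \<in> M" for x y
  proof
    have c: "x \<in> carrier G" "y \<in> carrier G" using that subgroup_carr[OF b(2)] by auto
    { assume "B #> x = B #> y"
      then have "x \<in> B #> y" using rcos_self[OF c(1) b(1)] by simp
      then obtain u where u: "u \<in> B" "x = u \<otimes> y" unfolding r_coset_def by blast
      have "u \<in> carrier G" using u subgroup_carr[OF b(1)] by blast
      then have "x \<otimes> inv y = u" using u(2) c by (simp add: grp)
      then show "x \<otimes> inv y \<in> B" using u by simp }
    { assume a: "x \<otimes> inv y \<in> B"
      have "x = (x \<otimes> inv y) \<otimes> y" using c by (simp add: grp)
      then have "x \<in> B #> y" using a unfolding r_coset_def by blast
      then show "B #> x = B #> y" using repr_independence[OF _ c(2) b(1)] by simp }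
  qed
  show "comm_group (?M Mod B)"
  proof (rule group.group_comm_groupI[OF N.factorgroup_is_group])
    fix u v assume "u \<in> carrier (?M Mod B)" "v \<in> carrier (?M Mod B)"
    then obtain x y where xy: "x \<in> M" "y \<in> M" "u = B #> x" "v = B #> y" unfolding car by blast
    have c: "x \<in> carrier G" "y \<in> carrier G" using xy subgroup_carr[OF b(2)] by auto
    have m: "x \<otimes> y \<in> M" "y \<otimes> x \<in> M" using xy subgroup.m_closed[OF b(2)] by auto
    have "(x \<otimes> y) \<otimes> inv (y \<otimes> x) = x \<otimes> y \<otimes> inv x \<otimes> inv y" using c by (simp add: grp)
    then have "(x \<otimes> y) \<otimes> inv (y \<otimes> x) \<in> B" using ab xy(1,2) by simp
    then have "B #> (x \<otimes> y) = B #> (y \<otimes> x)" using eq m by simp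
    then show "u \<otimes>\<^bsub>?M Mod B\<^esub> v = v \<otimes>\<^bsub>?M Mod B\<^esub> u"
      using hom xy unfolding hom_def by simp
  qed
qed

text \<open>The transversal is adapted to the double cosets \<open>M x S\<close>: right translation by \<open>S\<close> permutes the
  representatives of the cosets other than \<open>M\<close> up to \<open>D\<close>, so that these cosets contribute nothing to
  the transfer of an element of \<open>S\<close>.\<close>
lemma transfer_evaluation:
  assumes B: "normal_in B M" and ab: "\<forall>x\<in>M. \<forall>y\<in>M. x \<otimes> y \<otimes> inv x \<otimes> inv y \<in> B"
    and D: "normal_in D (carrier G)" "D \<subseteq> B"
    and S: "subgroup S G" "S \<subseteq> M"
    and ti: "\<And>x. x \<in> carrier G \<Longrightarrow> x \<notin> M \<Longrightarrow> M \<inter> conj_set x S \<subseteq> D"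
  shows "\<exists>V \<in> hom G ((G\<lparr>carrier := M\<rparr>) Mod B). (\<forall>u\<in>S. V u = B #> u) \<and> (\<forall>d\<in>D. V d = B)"
proof -
  let ?A = "(G\<lparr>carrier := M\<rparr>) Mod B"
  note MA = Mod_abelian[OF B ab]
  note b = normal_inD[OF B]
  note M = b(2)
  note cc = subgroup_carr[OF M] subgroup_carr[OF S(1)]
  interpret A: comm_group ?A by (rule MA(1))
  \<comment> \<open>The chosen representative depends on a coset \<open>c\<close> only through the
    double coset \<open>c <#> S\<close>, so \<open>c\<close> and \<open>c #> u\<close> share it for
    \<open>u\<close> in \<open>S\<close>.\<close>
  define r where "r O' = (SOME x. x \<in> O')" for O' :: "'a set"
  define t where "t c = r (c <#> S) \<otimes> (SOME v. v \<in> S \<and> r (c <#> S) \<otimes> v \<in> c)" for c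
  have rt: "r (c <#> S) \<in> c <#> S \<and> r (c <#> S) \<in> carrier G \<and> t c \<in> c \<and> (\<exists>v\<in>S. t c = r (c <#> S) \<otimes> v)"
    if c: "c \<in> rcosets M" for c
  proof -
    have sub: "c <#> S \<subseteq> carrier G" using rcosets_mem(1)[OF M c] cc(2) by (rule set_mult_closed)
    have "c <#> S \<noteq> {}" using rcosets_mem(3)[OF M c] subgroup.one_closed[OF S(1)]
      unfolding set_mult_def by blast
    then have r: "r (c <#> S) \<in> c <#> S" unfolding r_def by (simp add: some_in_eq)
    then obtain y s where ys: "y \<in> c" "s \<in> S" "r (c <#> S) = y \<otimes> s" unfolding set_mult_mem by blast
    have "y \<in> carrier G" "s \<in> carrier G" using ys rcosets_mem(1)[OF M c] cc by auto
    then have "r (c <#> S) \<otimes> inv s \<in> c" using ys by (simp add: grp)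
    then have "\<exists>v. v \<in> S \<and> r (c <#> S) \<otimes> v \<in> c" using subgroup.m_inv_closed[OF S(1) ys(2)] by blast
    from someI_ex[OF this] show ?thesis using r sub unfolding t_def by blast
  qed
  have t: "\<forall>c\<in>rcosets M. t c \<in> c" using rt by blast
  define V where "V g = finprod ?A (\<lambda>c. B #> (t c \<otimes> g \<otimes> inv (t (c #> g)))) (rcosets M)" for g
  have V: "V \<in> hom G ?A" unfolding V_def by (rule transfer_hom[OF MA(1) M MA(2) t])
  have MC: "M \<in> rcosets M"
    using cc(1) coset_mult_one[OF cc(1)] unfolding RCOSETS_def by (metis (no_types, lifting) UN_iff insertI1 one_closed)
  have finC: "finite (rcosets M)"
    using fin rcosets_mem(1)[OF M] by (meson finite_Pow_iff finite_subset Pow_iff subsetI)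
  have one: "B #> x = B" if "x \<in> B" for x
    using coset_join2[OF _ b(1) that] that subgroup_carr[OF b(1)] by blast
  have Bc: "B #> x \<in> carrier ?A" if "x \<in> M" for x using that unfolding MA(5) by blast
  have "V u = B #> u" if u: "u \<in> S" for u
  proof -
    have uc: "u \<in> carrier G" and uM: "u \<in> M" using u cc S by auto
    \<comment> \<open>At the coset \<open>M\<close> the factor is a conjugate of \<open>u\<close>
      inside \<open>M\<close>, which equals \<open>u\<close> modulo \<open>B\<close>. Every other
      factor will be shown to lie in \<open>D\<close>.\<close>
    have contrib: "B #> (t c \<otimes> u \<otimes> inv (t (c #> u))) = (if M = c then B #> u else \<one>\<^bsub>?A\<^esub>)"
      if c: "c \<in> rcosets M" for c
    proof (cases "M = c")
      case True
      have "M #> u = M" using coset_join2[OF uc M uM] .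
      moreover have tM: "t M \<in> M" using bspec[OF t MC] .
      moreover have "t M \<otimes> u \<otimes> inv (t M) \<otimes> inv u \<in> B" using ab tM uM by blast
      moreover have "t M \<otimes> u \<otimes> inv (t M) \<in> M"
        using tM uM by (intro subgroup.m_closed[OF M] subgroup.m_inv_closed[OF M])
      ultimately show ?thesis using True MA(3) uM by simp
    next
      case False
      let ?x = "r (c <#> S)"
      note c' = rcosets_translate[OF M c uc]
      have "(c #> u) <#> S = c <#> (u <# S)"
        using rcos_assoc_lcos[OF rcosets_mem(1)[OF M c] cc(2) uc] .
      also have "u <# S = S" using coset_join3[OF uc S(1) u] .
      finally have e: "(c #> u) <#> S = c <#> S" .
      obtain v where v: "v \<in> S" "t c = ?x \<otimes> v" using rt[OF c] by blast
      obtain w where w: "w \<in> S" "t (c #> u) = ?x \<otimes> w" using rt[OF c'] unfolding e by blast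
      have x: "?x \<in> carrier G" "?x \<in> c <#> S" using rt[OF c] by blast+
      have vw: "v \<in> carrier G" "w \<in> carrier G" using v w cc by auto
      have xM: "?x \<notin> M"
      proof
        assume xM: "?x \<in> M"
        obtain y s where ys: "y \<in> c" "s \<in> S" "?x = y \<otimes> s" using x(2) unfolding set_mult_mem by blast
        have "y \<in> carrier G" "s \<in> carrier G" using ys rcosets_mem(1)[OF M c] cc by auto
        then have "y = ?x \<otimes> inv s" using ys(3) by (simp add: grp)
        moreover have "inv s \<in> M" using subgroup.m_inv_closed[OF S(1) ys(2)] S(2) by blast
        ultimately have "y \<in> M" using subgroup.m_closed[OF M xM] by simp
        then have "c = M" using rcosets_mem(2)[OF M c ys(1)] coset_join2[OF _ M] cc(1) by blast
        then show False using False by simp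
      qed
      \<comment> \<open>The factor lies in \<open>M\<close> and, by this formula, in the conjugate
        of \<open>S\<close> by a representative outside \<open>M\<close>, so \<open>ti\<close>
        applies.\<close>
      have eq: "t c \<otimes> u \<otimes> inv (t (c #> u)) = ?x \<otimes> (v \<otimes> u \<otimes> inv w) \<otimes> inv ?x"
        unfolding v(2) w(2) using x vw uc by (simp add: grp)
      have "v \<otimes> u \<otimes> inv w \<in> S"
        using v(1) u w(1) by (intro subgroup.m_closed[OF S(1)] subgroup.m_inv_closed[OF S(1)])
      then have "t c \<otimes> u \<otimes> inv (t (c #> u)) \<in> conj_set ?x S" unfolding eq conj_set_def by blast
      then have "t c \<otimes> u \<otimes> inv (t (c #> u)) \<in> D"
        using ti[OF x(1) xM] transversal_term(1)[OF M t c uc] by blast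
      then have "B #> (t c \<otimes> u \<otimes> inv (t (c #> u))) = B" using D(2) one by blast
      then show ?thesis using False MA(4) by simp
    qed
    have "V u = finprod ?A (\<lambda>c. if M = c then B #> u else \<one>\<^bsub>?A\<^esub>) (rcosets M)"
      unfolding V_def by (rule A.finprod_cong') (use contrib Bc[OF uM] A.one_closed in auto)
    also have "\<dots> = B #> u" using A.finprod_singleton[OF MC finC, of "\<lambda>_. B #> u"] Bc[OF uM] by simp
    finally show ?thesis .
  qed
  moreover have "V d = B" if d: "d \<in> D" for d
  proof -
    have dc: "d \<in> carrier G" using d normal_inD(3)[OF D(1)] by blast
    \<comment> \<open>Since \<open>D\<close> is normal in \<open>G\<close> and contained in
      \<open>M\<close>, right translation by \<open>d\<close> fixes every coset, and each factor is
      a conjugate of \<open>d\<close>.\<close>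
    have "B #> (t c \<otimes> d \<otimes> inv (t (c #> d))) = \<one>\<^bsub>?A\<^esub>" if c: "c \<in> rcosets M" for c
    proof -
      have tc: "t c \<in> carrier G" using transversal_term(2)[OF M t c dc] .
      have k: "t c \<otimes> d \<otimes> inv (t c) \<in> D" using normal_inD(4)[OF D(1) tc d] .
      have kM: "t c \<otimes> d \<otimes> inv (t c) \<in> M" using k D(2) b(3) by blast
      have ct: "c = M #> t c" using rcosets_mem(2)[OF M c bspec[OF t c]] .
      have "c #> d = M #> (t c \<otimes> d)" using ct tc dc cc(1) by (metis coset_mult_assoc)
      also have "t c \<otimes> d = (t c \<otimes> d \<otimes> inv (t c)) \<otimes> t c" using tc dc by (simp add: grp)
      also have "M #> \<dots> = M #> (t c \<otimes> d \<otimes> inv (t c)) #> t c"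
        by (rule coset_mult_assoc[symmetric]) (use tc dc cc in auto)
      also have "\<dots> = c" using coset_join2[OF _ M kM] ct tc dc by simp
      finally have "c #> d = c" .
      then show ?thesis using k D(2) one MA(4) by auto
    qed
    then have "V d = finprod ?A (\<lambda>c. \<one>\<^bsub>?A\<^esub>) (rcosets M)"
      unfolding V_def by (intro A.finprod_cong') (use A.one_closed in auto)
    then show ?thesis using A.finprod_one MA(4) by simp
  qed
  ultimately show ?thesis using V by blast
qed

subsection \<open>Nilpotent maximal normalizers\<close>

lemma normaliser_set_mult:
  assumes "A \<subseteq> carrier G" "B \<subseteq> carrier G"
  shows "normaliser A \<inter> normaliser B \<subseteq> normaliser (A <#> B)"
proof
  fix g assume g: "g \<in> normaliser A \<inter> normaliser B"
  then have gA: "\<forall>x\<in>A. g \<otimes> x \<otimes> inv g \<in> A" and gB: "\<forall>x\<in>B. g \<otimes> x \<otimes> inv g \<in> B" and gc: "g \<in> carrier G"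
    using normaliser_iff[OF assms(1)] normaliser_iff[OF assms(2)] by auto
  have "g \<otimes> x \<otimes> inv g \<in> A <#> B" if x: "x \<in> A <#> B" for x
  proof -
    obtain a b where ab: "a \<in> A" "b \<in> B" "x = a \<otimes> b" using x unfolding set_mult_mem by blast
    have "a \<in> carrier G" "b \<in> carrier G" using ab assms by auto
    then have "g \<otimes> x \<otimes> inv g = (g \<otimes> a \<otimes> inv g) \<otimes> (g \<otimes> b \<otimes> inv g)" using ab(3) gc by (simp add: grp)
    then show ?thesis unfolding set_mult_mem using bspec[OF gA ab(1)] bspec[OF gB ab(2)] by blast
  qed
  then show "g \<in> normaliser (A <#> B)" using normaliser_iff[OF set_mult_closed[OF assms]] gc by blast
qed

lemma normaliser_carrier_iff: "subgroup A G \<Longrightarrow> normaliser A = carrier G \<longleftrightarrow> normal_in A (carrier G)"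
  unfolding normal_in_iff using subgroup_carr subgroup_self normaliser_subgroup[THEN subgroup_carr] by blast

lemma le_normaliser_normal: "\<lbrakk>normal_in N (carrier G); subgroup A G\<rbrakk> \<Longrightarrow> A \<subseteq> normaliser N"
  using normal_inD(5) subgroup_carr by blast

lemma maximalD:
  assumes "maximal_subgroup G K"
  shows "subgroup K G" "K \<noteq> carrier G" "\<And>J. subgroup J G \<Longrightarrow> K \<subseteq> J \<Longrightarrow> J = K \<or> J = carrier G"
  using assms unfolding maximal_subgroup_def by auto

lemma p_subgroup_le_normal_sylow:
  assumes q: "Factorial_Ring.prime q" and S: "sylow_in q S M" "normal_in S M"
    and R: "subgroup R G" "R \<subseteq> M" "card R = q ^ k"
  shows "R \<subseteq> S"
  using normal_contains_p_subgroup[OF q S(2) sylow_inD(5)[OF S(1)] R] .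

lemma prime_dvd_card_pgroup:
  assumes "subgroup A G" "\<not> A \<subseteq> D" "\<one> \<in> D" "card A = q ^ k"
  shows "q dvd card A"
proof (cases k)
  case 0
  then have "card A = 1" using assms by simp
  then obtain a where "A = {a}" by (rule card_1_singletonE)
  then show ?thesis using subgroup.one_closed[OF assms(1)] assms(2,3) by auto
qed (use assms in simp)

end

text \<open>The situation reached once a maximal subgroup is known to be nilpotent and the
  normalizer of a Sylow subgroup. \<open>Z\<close> is trivial in one application and the normal
  Sylow \<open>p\<close>-subgroup in the other; \<open>maximal_cases\<close> speaks only of maximal
  subgroups above it.\<close>

locale sylow_normalizer = fin_group +
  fixes s :: nat and Z S M :: "'a set"
  assumes s: "Factorial_Ring.prime s"
    and Z: "normal_in Z (carrier G)" "Z \<subseteq> M"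
    and S: "sylow_in s S (carrier G)"
    and M_eq: "M = normaliser S"
    and M_max: "maximal_subgroup G M"
    and M_nilp: "nilpotent_in M"
    and maximal_cases: "\<And>K. \<lbrakk>maximal_subgroup G K; Z \<subseteq> K; s dvd card K\<rbrakk> \<Longrightarrow>
      normal_in K (carrier G) \<or> nilpotent_in K"
begin

lemmas M = maximalD[OF M_max] and Ss = sylow_inD(1)[OF S] and Zs = normal_inD(1)[OF Z(1)]

text \<open>The intersection of all conjugates of \<open>M\<close>.\<close>

definition core :: "'a set" where
  "core = {x \<in> carrier G. \<forall>g\<in>carrier G. g \<otimes> x \<otimes> inv g \<in> M}"

lemma core: "normal_in core (carrier G)" "core \<subseteq> M"
  "\<And>N. normal_in N (carrier G) \<Longrightarrow> N \<subseteq> M \<Longrightarrow> N \<subseteq> core"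
proof -
  have "subgroup core G"
  proof (rule subgroupI)
    show "core \<subseteq> carrier G" unfolding core_def by blast
    have "\<one> \<in> core" unfolding core_def using subgroup.one_closed[OF M(1)] by simp
    then show "core \<noteq> {}" by blast
    fix a assume a: "a \<in> core"
    then have ac: "a \<in> carrier G" unfolding core_def by blast
    have "g \<otimes> inv a \<otimes> inv g \<in> M" if g: "g \<in> carrier G" for g
    proof -
      have "inv (g \<otimes> a \<otimes> inv g) \<in> M" using a g unfolding core_def by (auto intro: subgroup.m_inv_closed[OF M(1)])
      then show ?thesis using ac g by (simp add: grp)
    qed
    then show "inv a \<in> core" unfolding core_def using ac by simp
    fix b assume b: "b \<in> core"
    then have bc: "b \<in> carrier G" unfolding core_def by blast
    have "g \<otimes> (a \<otimes> b) \<otimes> inv g \<in> M" if g: "g \<in> carrier G" for g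
    proof -
      have "(g \<otimes> a \<otimes> inv g) \<otimes> (g \<otimes> b \<otimes> inv g) \<in> M"
        using a b g unfolding core_def by (auto intro: subgroup.m_closed[OF M(1)])
      then show ?thesis using ac bc g by (simp add: grp)
    qed
    then show "a \<otimes> b \<in> core" unfolding core_def using ac bc by simp
  qed
  moreover have "h \<otimes> x \<otimes> inv h \<in> core" if h: "h \<in> carrier G" and x: "x \<in> core" for h x
  proof -
    have xc: "x \<in> carrier G" using x unfolding core_def by blast
    have "g \<otimes> (h \<otimes> x \<otimes> inv h) \<otimes> inv g \<in> M" if g: "g \<in> carrier G" for g
    proof -
      have "(g \<otimes> h) \<otimes> x \<otimes> inv (g \<otimes> h) \<in> M" using x g h unfolding core_def by blast
      then show ?thesis using xc g h by (simp add: grp)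
    qed
    then show ?thesis unfolding core_def using xc h by simp
  qed
  ultimately show "normal_in core (carrier G)"
    unfolding normal_in_def using subgroup_self subgroup_carr by blast
  show "core \<subseteq> M"
  proof
    fix x assume "x \<in> core"
    then have "x \<in> carrier G" "\<one> \<otimes> x \<otimes> inv \<one> \<in> M" unfolding core_def by blast+
    then show "x \<in> M" by simp
  qed
  fix N assume N: "normal_in N (carrier G)" "N \<subseteq> M"
  show "N \<subseteq> core"
    unfolding core_def using normal_inD(3,4)[OF N(1)] N(2) by blast
qed

lemmas core_sub = normal_inD(1)[OF core(1)]

lemma S_normal: "S \<subseteq> M" "sylow_in s S M" "normal_in S M"
proof -
  show 1: "S \<subseteq> M" unfolding M_eq by (rule normaliser_self[OF Ss])
  then show "normal_in S M" unfolding normal_in_iff using Ss M(1) M_eq by simp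
  have "card (carrier G) div card S = (card (carrier G) div card M) * (card M div card S)"
    by (rule card_div_mult[OF Ss M(1) subgroup_self 1 subgroup_carr[OF M(1)]])
  then show "sylow_in s S M" using S 1 M(1) unfolding sylow_in_def by (metis dvd_mult)
qed

lemma s_subgroup_le: "\<lbrakk>subgroup R G; R \<subseteq> M; card R = s ^ k\<rbrakk> \<Longrightarrow> R \<subseteq> S"
  by (rule p_subgroup_le_normal_sylow[OF s S_normal(2,3)])

lemma conj_set_S: assumes "g \<in> carrier G"
  shows "subgroup (conj_set g S) G" "\<exists>k. card (conj_set g S) = s ^ k" "nilpotent_in (conj_set g S)" "conj_set g S \<subseteq> S \<or> S \<subseteq> conj_set g S \<Longrightarrow> conj_set g S = S"
proof -
  show 1: "subgroup (conj_set g S) G" by (rule conj_set_subgroup[OF assms Ss])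
  have c: "card (conj_set g S) = card S" using assms subgroup_carr[OF Ss] by simp
  then show "\<exists>k. card (conj_set g S) = s ^ k" using sylow_inD(4)[OF S] by simp
  show "nilpotent_in (conj_set g S)" by (rule nilpotent_in_cj[OF nilpotent_in_mono[OF M_nilp Ss S_normal(1)] assms])
  assume "conj_set g S \<subseteq> S \<or> S \<subseteq> conj_set g S"
  then show "conj_set g S = S"
    using card_subset_eq[OF subgroup_finite[OF Ss] _ c] card_subset_eq[OF subgroup_finite[OF 1] _ c[symmetric]] by blast
qed

text \<open>Otherwise every conjugate of \<open>S\<close> would be an \<open>s\<close>-subgroup of
  \<open>M\<close>, hence inside the normal Sylow subgroup \<open>S\<close> of \<open>M\<close>.
  Then \<open>S\<close> would be normal in \<open>G\<close> and its normalizer \<open>M\<close>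
  would not be proper.\<close>

lemma S_not_core: "\<not> S \<subseteq> core"
proof
  assume a: "S \<subseteq> core"
  have "normaliser S = carrier G"
  proof (intro equalityI subsetI)
    fix g assume g: "g \<in> carrier G"
    have "conj_set g S \<subseteq> M" using conj_set_mono[OF a] normal_inD(6)[OF core(1) g] core(2) by blast
    moreover obtain k where "card (conj_set g S) = s ^ k" using conj_set_S(2)[OF g] by blast
    ultimately have "conj_set g S \<subseteq> S" using s_subgroup_le[OF conj_set_S(1)[OF g]] by blast
    then show "g \<in> normaliser S" using g conj_set_S(4)[OF g] unfolding normaliser_def by blast
  qed (auto simp: normaliser_def)
  then show False using M(2) M_eq by simp
qed

text \<open>If \<open>Z Q\<close> were not normal, its normalizer would lie in a nilpotent maximal subgroup \<open>K\<close> with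
  \<open>s\<close> dividing \<open>|K|\<close>; such a \<open>K\<close> is the normalizer of a Sylow \<open>s\<close>-subgroup, hence a conjugate of \<open>M\<close>,
  contrary to the choice of \<open>q\<close>.\<close>
lemma normal_supplement:
  assumes L: "normal_in L (carrier G)" "\<not> L \<subseteq> M" "core \<subseteq> L"
    and idx: "s dvd card (carrier G) div card L"
  shows "\<exists>t Q k. Factorial_Ring.prime t \<and> subgroup Q G \<and> card Q = t ^ k \<and>
    normal_in (Z <#> Q) (carrier G) \<and> (Z <#> Q) <#> M = carrier G"
proof -
  note Ls = normal_inD(1)[OF L(1)]
  let ?I = "L \<inter> M"
  have I: "subgroup ?I G" by (rule subgroup_Int[OF Ls M(1)])
  have "card L div card ?I \<noteq> 1"
  proof
    assume "card L div card ?I = 1"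
    then have "card ?I = card L" using card_div(1)[OF I Ls inf_le1] by (metis mult_1)
    then have "?I = L" by (intro card_subset_eq[OF subgroup_finite[OF Ls] inf_le1])
    then show False using L(2) by blast
  qed
  then obtain q where q: "Factorial_Ring.prime q" "q dvd card L div card ?I" using prime_factor_nat by blast
  obtain Q where Q: "sylow_in q Q L" using sylow_exists[OF q(1) Ls] by blast
  note Qs = sylow_inD[OF Q]
  \<comment> \<open>A conjugate of \<open>Q\<close> is again Sylow in \<open>L\<close>. Inside
    \<open>M\<close> it would make the index of \<open>L \<inter> M\<close> in \<open>L\<close>
    prime to \<open>q\<close>, against the choice of \<open>q\<close>.\<close>
  have nQ: "\<not> conj_set x Q \<subseteq> M" if x: "x \<in> carrier G" for x
  proof
    assume a: "conj_set x Q \<subseteq> M"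
    have "conj_set x Q \<subseteq> L" using conj_set_mono[OF Qs(3)] normal_inD(6)[OF L(1) x] by blast
    with a have sub: "conj_set x Q \<subseteq> ?I" and "sylow_in q (conj_set x Q) L" using sylow_cj[OF Q x] by auto
    then have "\<not> q dvd card L div card (conj_set x Q)" by (intro sylow_inD(5))
    moreover have "card L div card (conj_set x Q) = (card L div card ?I) * (card ?I div card (conj_set x Q))"
      by (rule card_div_mult[OF conj_set_subgroup[OF x Qs(1)] I Ls sub inf_le1])
    ultimately show False using q(2) by simp
  qed
  let ?Y = "Z <#> Q"
  have Y: "subgroup ?Y G" by (rule set_mult_subgroup[OF Zs Qs(1) le_normaliser_normal[OF Z(1) Qs(1)]])
  note Yub = set_mult_ub[OF Zs Qs(1)]
  have nrmQ: "normaliser Q \<subseteq> normaliser ?Y"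
    using normaliser_set_mult[OF subgroup_carr[OF Zs] subgroup_carr[OF Qs(1)]]
      le_normaliser_normal[OF Z(1) normaliser_subgroup[OF subgroup_carr[OF Qs(1)]]] by blast
  note YN = normaliser_self[OF Y]
  have "\<not> Q \<subseteq> M" using nQ[of \<one>] subgroup_carr[OF Qs(1)] by simp
  then have YM: "\<not> ?Y \<subseteq> M" using Yub by blast
  have "normal_in ?Y (carrier G)"
  proof (rule ccontr)
    assume "\<not> ?thesis"
    then have "normaliser ?Y \<noteq> carrier G" using normaliser_carrier_iff[OF Y] by blast
    then obtain K where K: "maximal_subgroup G K" "normaliser ?Y \<subseteq> K"
      using maximal_subgroup_exists[OF normaliser_subgroup[OF subgroup_carr[OF Y]]] by blast
    note Km = maximalD[OF K(1)]
    have nK: "\<not> normal_in K (carrier G)" using frattini_normal[OF q(1) L(1) Q] K(2) nrmQ Km(2) by blast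
    have "L <#> normaliser Q \<subseteq> L <#> K" using nrmQ K(2) by (intro mono_set_mult) auto
    then have LK: "L <#> K = carrier G"
      using frattini[OF q(1) L(1) Q] set_mult_closed[OF subgroup_carr[OF Ls] subgroup_carr[OF Km(1)]] by blast
    \<comment> \<open>From \<open>L <#> K = carrier G\<close> the divisibility \<open>idx\<close> is
      transported to \<open>K\<close>, which makes \<open>maximal_cases\<close> applicable.\<close>
    have "card (carrier G) div card L = card K div card (L \<inter> K)"
      using card_set_mult_div[OF Ls Km(1)] LK subgroup_self by simp
    with idx have sK: "s dvd card K div card (L \<inter> K)" by simp
    then have "s dvd card K"
      using card_div(1)[OF subgroup_Int[OF Ls Km(1)] Km(1) inf_le2] by (metis dvd_mult2)
    moreover have "Z \<subseteq> K" using Yub(1) YN K(2) by blast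
    ultimately have K_nilp: "nilpotent_in K" using maximal_cases[OF K(1)] nK by blast
    obtain R where R: "sylow_in s R K" using sylow_exists[OF s Km(1)] by blast
    note Rs = sylow_inD[OF R]
    obtain k where k: "card R = s ^ k" using Rs(4) by blast
    have R_norm: "normal_in R K" by (rule nilpotent_in_sylow_normal[OF s K_nilp R])
    obtain h where h: "h \<in> carrier G" "R \<subseteq> conj_set h S" using sylow_conj[OF s S Rs(1) subgroup_carr[OF Rs(1)] k] by blast
    note T = conj_set_S[OF h(1)]
    \<comment> \<open>A normal \<open>R\<close> would lie in the core, hence in
      \<open>L \<inter> K\<close>. The index of \<open>R\<close> in \<open>K\<close> would then be a
      multiple of that of \<open>L \<inter> K\<close>, which \<open>s\<close> divides.\<close>
    have "normaliser R \<noteq> carrier G"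
    proof
      assume "normaliser R = carrier G"
      then have Rn: "normal_in R (carrier G)" using normaliser_carrier_iff[OF Rs(1)] by blast
      have "R = conj_set (inv h) R" using normal_inD(6)[OF Rn] h(1) by simp
      also have "\<dots> \<subseteq> S" using conj_set_mono[OF h(2), of "inv h"] h(1) subgroup_carr[OF Ss] by simp
      finally have "R \<subseteq> core" using core(3)[OF Rn] S_normal(1) by blast
      then have RI: "R \<subseteq> L \<inter> K" using L(3) Rs(3) by blast
      have "card K div card R = (card K div card (L \<inter> K)) * (card (L \<inter> K) div card R)"
        by (rule card_div_mult[OF Rs(1) subgroup_Int[OF Ls Km(1)] Km(1) RI inf_le2])
      then show False using sK Rs(5) by simp
    qed
    then have nR: "normaliser R = K"
      using Km(3)[OF normaliser_subgroup[OF subgroup_carr[OF Rs(1)]] normal_inD(5)[OF R_norm]] by blast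
    \<comment> \<open>Otherwise some element of the conjugate of \<open>S\<close> outside
      \<open>R\<close> normalizes \<open>R\<close> and so lies in \<open>K\<close>; but
      \<open>R\<close> contains all \<open>s\<close>-subgroups of \<open>K\<close>.\<close>
    have "R = conj_set h S"
    proof (rule ccontr)
      assume "R \<noteq> conj_set h S"
      then obtain g where g: "g \<in> conj_set h S - R" "g \<in> normaliser R"
        using nilpotent_in_normalizer[OF T(3) Rs(1)] h(2) by blast
      have TK: "subgroup (conj_set h S \<inter> K) G" by (rule subgroup_Int[OF T(1) Km(1)])
      obtain j where j: "card (conj_set h S \<inter> K) = s ^ j"
        using T(2) p_subgroup_sub[OF s TK T(1) inf_le1] by blast
      have "conj_set h S \<inter> K \<subseteq> R" by (rule p_subgroup_le_normal_sylow[OF s R R_norm TK inf_le2 j])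
      then show False using g nR by blast
    qed
    then have "K = conj_set h M" using nR normaliser_cj[OF h(1) subgroup_carr[OF Ss]] M_eq by simp
    then have "Q \<subseteq> conj_set h M" using Yub(2) YN K(2) by blast
    then have "conj_set (inv h) Q \<subseteq> M" using conj_set_mono[of Q "conj_set h M" "inv h"] h(1) subgroup_carr[OF M(1)] by simp
    then show False using nQ[of "inv h"] h(1) by simp
  qed
  moreover have "?Y <#> M = carrier G"
  proof -
    have "subgroup (?Y <#> M) G"
      by (rule set_mult_subgroup[OF Y M(1) le_normaliser_normal[OF calculation M(1)]])
    then show ?thesis using M(3) set_mult_ub[OF Y M(1)] YM by blast
  qed
  ultimately show ?thesis using q(1) Qs(1,4) by blast
qed

text \<open>\<open>H\<close> is the normal \<open>s\<close>-complement of the nilpotent group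
  \<open>M\<close>. Comparing indices gives \<open>H <#> S = M\<close>, and \<open>H\<close> and
  \<open>S\<close> are normal in \<open>M\<close> of coprime orders, so they commute
  elementwise.\<close>

lemma complement:
  "\<exists>H. normal_in H M \<and> coprime (card H) s \<and> H <#> S = M \<and> (\<forall>h\<in>H. \<forall>u\<in>S. h \<otimes> u = u \<otimes> h)"
proof -
  obtain H k where H: "normal_in H M" "coprime (card H) s" "card M = s ^ k * card H"
    using nilpotent_in_complement[OF M_nilp s] by blast
  note Hs = normal_inD(1)[OF H(1)]
  have HS: "subgroup (H <#> S) G"
    by (rule set_mult_subgroup[OF Hs Ss]) (use normal_inD(5)[OF H(1)] S_normal(1) in blast)
  note ub = set_mult_ub[OF Hs Ss]
  have sub: "H <#> S \<subseteq> M" by (rule set_mult_least[OF M(1) normal_inD(3)[OF H(1)] S_normal(1)])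
  have "card M div card H = (card M div card (H <#> S)) * (card (H <#> S) div card H)"
    by (rule card_div_mult[OF Hs HS M(1) ub(1) sub])
  moreover have "card M div card H = s ^ k" using H(3) subgroup_card_pos[OF Hs] by simp
  ultimately have "card M div card (H <#> S) dvd s ^ k" by (metis dvd_triv_left)
  moreover have "\<not> s dvd card M div card (H <#> S)"
    using card_div_mult[OF Ss HS M(1) ub(2) sub] sylow_inD(5)[OF S_normal(2)] by (metis dvd_mult2)
  ultimately have "card M div card (H <#> S) = 1" using prime_power_dvd_cases[OF s] by blast
  then have "card (H <#> S) = card M" using card_div(1)[OF HS M(1) sub] by (metis mult_1)
  then have HSM: "H <#> S = M" by (rule card_subset_eq[OF subgroup_finite[OF M(1)] sub])
  obtain j where "card S = s ^ j" using sylow_inD(4)[OF S] by blast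
  then have "coprime (card H) (card S)" using H(2) by simp
  then have "H \<inter> S = {\<one>}" by (rule coprime_Int_trivial[OF Hs Ss])
  then have "h \<otimes> u = u \<otimes> h" if "h \<in> H" "u \<in> S" for h u
    using commute_trivial_Int[OF H(1) S_normal(3) _ that] by blast
  then show ?thesis using H(1,2) HSM by blast
qed

text \<open>A maximal intersection \<open>Y\<close> not inside the core would be normalized by the \<open>s\<close>-complement of \<open>M\<close>,
  so a maximal subgroup above its normalizer cannot be normal; being nilpotent, it has
  only one Sylow \<open>s\<close>-subgroup, which would meet both \<open>S\<close> and \<open>S\<^sup>g\<close> in more than \<open>Y\<close>.\<close>
lemma trivial_intersection:
  assumes L: "normal_in L (carrier G)" "\<not> L \<subseteq> M" "core \<subseteq> L"
    and min: "\<forall>N. normal_in N (carrier G) \<longrightarrow> core \<subseteq> N \<longrightarrow> N \<subseteq> L \<longrightarrow> N = core \<or> N = L"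
    and SL: "S \<subseteq> L"
    and g: "g \<in> carrier G" "conj_set g S \<noteq> S"
  shows "S \<inter> conj_set g S \<subseteq> core"
proof (rule ccontr)
  assume neg: "\<not> ?thesis"
  note Ls = normal_inD(1)[OF L(1)]
  let ?P = "\<lambda>g. g \<in> carrier G \<and> conj_set g S \<noteq> S \<and> \<not> S \<inter> conj_set g S \<subseteq> core"
  let ?f = "\<lambda>g. card (S \<inter> conj_set g S)"
  have "?P g" using g neg by blast
  moreover have "\<forall>g. ?P g \<longrightarrow> ?f g < Suc (card S)"
    using card_mono[OF subgroup_finite[OF Ss] inf_le1] by (simp add: less_Suc_eq_le)
  ultimately have "\<exists>g. ?P g \<and> (\<forall>h. ?P h \<longrightarrow> ?f h \<le> ?f g)" by (rule ex_has_greatest_nat)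
  then obtain g where g: "g \<in> carrier G" "conj_set g S \<noteq> S" "\<not> S \<inter> conj_set g S \<subseteq> core"
    and gmax: "\<forall>h. ?P h \<longrightarrow> ?f h \<le> ?f g" by blast
  note T = conj_set_S[OF g(1)]
  let ?Y = "S \<inter> conj_set g S"
  have Y: "subgroup ?Y G" by (rule subgroup_Int[OF Ss T(1)])
  let ?W = "core <#> ?Y"
  have W: "subgroup ?W G" by (rule set_mult_subgroup[OF core_sub Y le_normaliser_normal[OF core(1) Y]])
  note ub = set_mult_ub[OF core_sub Y]
  have nrmY: "normaliser ?Y \<subseteq> normaliser ?W"
    using normaliser_set_mult[OF subgroup_carr[OF core_sub] subgroup_carr[OF Y]]
      le_normaliser_normal[OF core(1) normaliser_subgroup[OF subgroup_carr[OF Y]]] by blast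
  have "normaliser ?W \<noteq> carrier G"
  proof
    assume "normaliser ?W = carrier G"
    then have "normal_in ?W (carrier G)" using normaliser_carrier_iff[OF W] by blast
    moreover have "?W \<subseteq> M" by (rule set_mult_least[OF M(1) core(2)]) (use S_normal(1) in blast)
    ultimately have "?W \<subseteq> core" by (rule core(3))
    then show False using ub(2) g(3) by blast
  qed
  then obtain K where K: "maximal_subgroup G K" "normaliser ?W \<subseteq> K"
    using maximal_subgroup_exists[OF normaliser_subgroup[OF subgroup_carr[OF W]]] by blast
  note Km = maximalD[OF K(1)]
  have WK: "core \<subseteq> K" "?Y \<subseteq> K" using ub normaliser_self[OF W] K(2) by blast+
  obtain j where "card ?Y = s ^ j"
    using sylow_inD(4)[OF S] p_subgroup_sub[OF s Y Ss inf_le1] by blast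
  then have "s dvd card ?Y"
    using prime_dvd_card_pgroup[OF Y g(3) subgroup.one_closed[OF core_sub]] by blast
  then have "s dvd card K" using subgroup_card_dvd[OF Y Km(1) WK(2)] by (rule dvd_trans)
  moreover have "Z \<subseteq> K" using core(3)[OF Z] WK(1) by blast
  moreover have "\<not> normal_in K (carrier G)"
  proof
    assume Kn: "normal_in K (carrier G)"
    \<comment> \<open>\<open>K \<inter> L\<close> contains \<open>?Y\<close>, which is not inside
      the core, so minimality gives \<open>L \<subseteq> K\<close> and hence
      \<open>S \<subseteq> K\<close>. As \<open>H\<close> centralizes \<open>S\<close>, it
      normalizes \<open>?Y\<close> and lies in \<open>K\<close> too. Then \<open>K\<close> contains
      \<open>M\<close>, so \<open>K = M\<close>, which does not contain \<open>L\<close>.\<close>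
    have "K \<inter> L = core \<or> K \<inter> L = L"
      by (rule min[rule_format, OF normal_in_Int[OF Kn L(1)]]) (use WK(1) L(3) in blast)+
    moreover have "?Y \<subseteq> K \<inter> L" using WK(2) SL by blast
    ultimately have LK: "L \<subseteq> K" using g(3) by blast
    obtain H where H: "normal_in H M" "H <#> S = M" "\<forall>h\<in>H. \<forall>u\<in>S. h \<otimes> u = u \<otimes> h"
      using complement by blast
    note Hs = normal_inD(1)[OF H(1)]
    have "H \<subseteq> normaliser ?Y"
    proof
      fix h assume h: "h \<in> H"
      have hc: "h \<in> carrier G" using h subgroup_carr[OF Hs] by blast
      have "h \<otimes> y \<otimes> inv h = y" if y: "y \<in> ?Y" for y
      proof -
        have "y \<in> carrier G" using y subgroup_carr[OF Y] by blast
        then show ?thesis using bspec[OF bspec[OF H(3) h], of y] y hc by (simp add: grp)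
      qed
      then show "h \<in> normaliser ?Y" using normaliser_iff[OF subgroup_carr[OF Y]] hc by simp
    qed
    then have "H \<subseteq> K" using nrmY K(2) by blast
    moreover have "S \<subseteq> K" using SL LK by blast
    ultimately have MK: "M \<subseteq> K" using set_mult_least[OF Km(1)] H(2) by blast
    then have "K = M" using M(3)[OF Km(1)] Km(2) by blast
    then show False using LK L(2) by blast
  qed
  ultimately have K_nilp: "nilpotent_in K" using maximal_cases[OF K(1)] by blast
  obtain R where R: "sylow_in s R K" using sylow_exists[OF s Km(1)] by blast
  note Rs = sylow_inD[OF R]
  have R_norm: "normal_in R K" by (rule nilpotent_in_sylow_normal[OF s K_nilp R])
  obtain k where k: "card R = s ^ k" using Rs(4) by blast
  obtain h where h: "h \<in> carrier G" "R \<subseteq> conj_set h S" using sylow_conj[OF s S Rs(1) subgroup_carr[OF Rs(1)] k] by blast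
  \<comment> \<open>Normalizers grow in the nilpotent conjugate of \<open>S\<close>, so its
    intersection with the normalizer of \<open>?Y\<close> is strictly above \<open>?Y\<close>. This
    intersection is an \<open>s\<close>-subgroup of \<open>K\<close>, hence inside
    \<open>R\<close>.\<close>
  have grow: "\<exists>U. U \<subseteq> conj_set x S \<and> ?Y \<subset> U \<and> U \<subseteq> R" if x: "x \<in> carrier G" "?Y \<subset> conj_set x S" for x
  proof -
    note X = conj_set_S[OF x(1)]
    let ?U = "conj_set x S \<inter> normaliser ?Y"
    have U: "subgroup ?U G" by (rule subgroup_Int[OF X(1) normaliser_subgroup[OF subgroup_carr[OF Y]]])
    obtain a where a: "a \<in> conj_set x S - ?Y" "a \<in> normaliser ?Y" using nilpotent_in_normalizer[OF X(3) Y x(2)] by blast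
    have YU: "?Y \<subset> ?U" using a x(2) normaliser_self[OF Y] by blast
    obtain j where j: "card ?U = s ^ j" using X(2) p_subgroup_sub[OF s U X(1) inf_le1] by blast
    have "?U \<subseteq> R"
      by (rule p_subgroup_le_normal_sylow[OF s R R_norm U _ j]) (use nrmY K(2) in blast)
    then show ?thesis by (intro exI[of _ ?U] conjI inf_le1 YU)
  qed
  \<comment> \<open>The conjugate of \<open>S\<close> by \<open>h\<close> contains \<open>R\<close>,
    so it meets \<open>S\<close> in more than \<open>?Y\<close>. By the maximal choice of
    \<open>g\<close> it must be \<open>S\<close> itself.\<close>
  have "R \<subseteq> S"
  proof -
    have "?Y \<noteq> S" using T(4) g(2) by blast
    then have "?Y \<subset> conj_set \<one> S" using subgroup_carr[OF Ss] by auto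
    then obtain U where U: "U \<subseteq> S" "?Y \<subset> U" "U \<subseteq> R" using grow[of \<one>] subgroup_carr[OF Ss] by auto
    then have UI: "?Y \<subset> S \<inter> conj_set h S" using h(2) by blast
    then have "?f g < ?f h" using subgroup_finite[OF Ss] by (intro psubset_card_mono) auto
    moreover have "\<not> S \<inter> conj_set h S \<subseteq> core" using UI g(3) by blast
    ultimately have "conj_set h S = S" using gmax h(1) by (meson not_le)
    then show ?thesis using h(2) by simp
  qed
  \<comment> \<open>A subgroup of \<open>R\<close> strictly above \<open>?Y\<close> in the conjugate
    of \<open>S\<close> by \<open>g\<close> would lie in \<open>S\<close> as well, hence in
    \<open>?Y\<close>.\<close>
  have "?Y \<noteq> conj_set g S" using T(4) g(2) by blast
  then have "?Y \<subset> conj_set g S" by blast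
  then obtain U where "U \<subseteq> conj_set g S" "?Y \<subset> U" "U \<subseteq> R" using grow[OF g(1)] by blast
  then show False using \<open>R \<subseteq> S\<close> by blast
qed

text \<open>A maximal subgroup of a nilpotent group is normal because its normalizer is larger, and
  the quotient is abelian because the preimage of its centre is larger than
  \<open>B\<close>.\<close>

lemma commutators_in_maximal:
  assumes B: "subgroup B G" "B \<subset> M"
    and B_max: "\<forall>J. subgroup J G \<longrightarrow> B \<subseteq> J \<longrightarrow> J \<subseteq> M \<longrightarrow> J = B \<or> J = M"
  shows "normal_in B M" "\<forall>x\<in>M. \<forall>y\<in>M. x \<otimes> y \<otimes> inv x \<otimes> inv y \<in> B"
proof -
  obtain g where g: "g \<in> M - B" "\<forall>y\<in>M. g \<otimes> y \<otimes> inv g \<otimes> inv y \<in> B" using nilpD(2)[OF M_nilp B] by blast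
  obtain a where a: "a \<in> M - B" "a \<in> normaliser B" using nilpotent_in_normalizer[OF M_nilp B] by blast
  have "M \<inter> normaliser B = M"
    using B_max[rule_format, OF subgroup_Int[OF M(1) normaliser_subgroup[OF subgroup_carr[OF B(1)]]]] B(2) normaliser_self[OF B(1)] a by blast
  then show BM: "normal_in B M" unfolding normal_in_iff using B M(1) by blast
  let ?k = "\<lambda>x y. x \<otimes> y \<otimes> inv x \<otimes> inv y"
  \<comment> \<open>The preimage in \<open>M\<close> of the centre of \<open>M\<close> modulo
    \<open>B\<close>; it contains \<open>B\<close> and also \<open>g\<close>, which is outside
    \<open>B\<close>.\<close>
  define C where "C = {x \<in> M. \<forall>y\<in>M. ?k x y \<in> B}"
  have c: "x \<in> carrier G" if "x \<in> M" for x using that subgroup_carr[OF M(1)] by blast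
  note bc = subgroup.m_closed[OF B(1)] subgroup.m_inv_closed[OF B(1)]
  have "subgroup C G"
  proof (rule subgroupI)
    show "C \<subseteq> carrier G" unfolding C_def using c by blast
    show "C \<noteq> {}" unfolding C_def using g by blast
    fix x assume x: "x \<in> C"
    then have xM: "x \<in> M" and xB: "\<And>y. y \<in> M \<Longrightarrow> ?k x y \<in> B" unfolding C_def by blast+
    have ix: "inv x \<in> M" by (rule subgroup.m_inv_closed[OF M(1) xM])
    have "?k (inv x) y \<in> B" if y: "y \<in> M" for y
    proof -
      have "inv x \<otimes> inv (?k x y) \<otimes> inv (inv x) \<in> B"
        by (rule normal_inD(4)[OF BM ix bc(2)[OF xB[OF y]]])
      then show ?thesis using c[OF xM] c[OF y] by (simp add: grp)
    qed
    then show "inv x \<in> C" unfolding C_def using ix by blast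
    fix z assume z: "z \<in> C"
    then have zM: "z \<in> M" and zB: "\<And>y. y \<in> M \<Longrightarrow> ?k z y \<in> B" unfolding C_def by blast+
    have "?k (x \<otimes> z) y \<in> B" if y: "y \<in> M" for y
    proof -
      have "(x \<otimes> ?k z y \<otimes> inv x) \<otimes> ?k x y \<in> B"
        by (rule bc(1)[OF normal_inD(4)[OF BM xM zB[OF y]] xB[OF y]])
      then show ?thesis using c[OF xM] c[OF zM] c[OF y] by (simp add: grp)
    qed
    then show "x \<otimes> z \<in> C" unfolding C_def using subgroup.m_closed[OF M(1) xM zM] by blast
  qed
  moreover have "B \<subseteq> C"
  proof
    fix x assume x: "x \<in> B"
    then have xM: "x \<in> M" using B(2) by blast
    have "?k x y \<in> B" if y: "y \<in> M" for y
    proof -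
      have "x \<otimes> (y \<otimes> inv x \<otimes> inv y) \<in> B" by (rule bc(1)[OF x normal_inD(4)[OF BM y bc(2)[OF x]]])
      then show ?thesis using c[OF xM] c[OF y] by (simp add: grp)
    qed
    then show "x \<in> C" unfolding C_def using xM by blast
  qed
  moreover have "C \<subseteq> M" "g \<in> C" unfolding C_def using g by blast+
  ultimately have "C = M" using B_max g(1) by blast
  then show "\<forall>x\<in>M. \<forall>y\<in>M. ?k x y \<in> B" unfolding C_def by blast
qed

text \<open>Otherwise \<open>S\<close> lies in \<open>L\<close>, and the transfer \<open>V\<close>
  to \<open>M\<close> modulo \<open>B\<close>, with \<open>B\<close> maximal in \<open>M\<close>
  above the core and the complement \<open>H\<close>, is the projection on \<open>S\<close> and
  trivial on the core. By minimality its kernel meets \<open>L\<close> either in \<open>L\<close>,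
  which forces \<open>M\<close> into \<open>B\<close>, or in the core, which forces \<open>L\<close>
  into \<open>M\<close>.\<close>

lemma prime_dvd_minimal_index:
  assumes L: "normal_in L (carrier G)" "\<not> L \<subseteq> M" "core \<subseteq> L"
    and min: "\<forall>N. normal_in N (carrier G) \<longrightarrow> core \<subseteq> N \<longrightarrow> N \<subseteq> L \<longrightarrow> N = core \<or> N = L"
  shows "s dvd card (carrier G) div card L"
proof (rule ccontr)
  assume idx: "\<not> ?thesis"
  note Ls = normal_inD(1)[OF L(1)]
  obtain j where j: "card S = s ^ j" using sylow_inD(4)[OF S] by blast
  have SL: "S \<subseteq> L" by (rule normal_contains_p_subgroup[OF s L(1) idx Ss subgroup_carr[OF Ss] j])
  obtain H where H: "normal_in H M" "coprime (card H) s" "H <#> S = M" using complement by blast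
  note Hs = normal_inD(1)[OF H(1)]
  let ?A = "core <#> H"
  have A: "subgroup ?A G" by (rule set_mult_subgroup[OF core_sub Hs le_normaliser_normal[OF core(1) Hs]])
  \<comment> \<open>If equality held, the index of the core in \<open>M\<close> would divide
    \<open>card H\<close> and be prime to \<open>s\<close>, so the core would contain
    \<open>S\<close>.\<close>
  have "?A \<noteq> M"
  proof
    assume "?A = M"
    then have "card M div card core = card H div card (core \<inter> H)"
      using card_set_mult_div[OF core_sub Hs A] by simp
    then have "card M div card core dvd card H"
      using card_div(1)[OF subgroup_Int[OF core_sub Hs] Hs inf_le2] by (metis dvd_triv_left)
    moreover have "\<not> s dvd card H" using H(2) s by (metis coprime_common_divisor dvd_refl not_prime_unit)
    ultimately have nd: "\<not> s dvd card M div card core" using dvd_trans by blast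
    have "normal_in (core \<inter> M) M" by (rule normal_in_Int_subgroup[OF core(1) M(1) subgroup_carr[OF M(1)]])
    moreover have "core \<inter> M = core" using core(2) by blast
    ultimately have "S \<subseteq> core"
      using normal_contains_p_subgroup[OF s _ nd Ss S_normal(1) j] by simp
    then show False using S_not_core by blast
  qed
  moreover have "?A \<subseteq> M" by (rule set_mult_least[OF M(1) core(2) normal_inD(3)[OF H(1)]])
  ultimately have AM: "subgroup ?A G \<and> ?A \<subseteq> ?A \<and> ?A \<subset> M" using A by blast
  have "\<exists>B. (subgroup B G \<and> ?A \<subseteq> B \<and> B \<subset> M) \<and>
      (\<forall>J. subgroup J G \<and> ?A \<subseteq> J \<and> J \<subset> M \<longrightarrow> card J \<le> card B)"
    by (rule ex_max_card[of "\<lambda>B. subgroup B G \<and> ?A \<subseteq> B \<and> B \<subset> M", OF AM]) (use subgroup_carr in blast)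
  then obtain B where B: "subgroup B G" "?A \<subseteq> B" "B \<subset> M"
    and Bm: "\<forall>J. subgroup J G \<and> ?A \<subseteq> J \<and> J \<subset> M \<longrightarrow> card J \<le> card B" by blast
  have B_max: "\<forall>J. subgroup J G \<longrightarrow> B \<subseteq> J \<longrightarrow> J \<subseteq> M \<longrightarrow> J = B \<or> J = M"
  proof (intro allI impI, rule disjCI)
    fix J assume J: "subgroup J G" "B \<subseteq> J" "J \<subseteq> M" and "J \<noteq> M"
    have "J \<subset> M" using J(3) \<open>J \<noteq> M\<close> by blast
    moreover have "?A \<subseteq> J" using B(2) J(2) by (rule order_trans)
    ultimately have "card J \<le> card B" using Bm J(1) by blast
    then show "J = B" using card_seteq[OF subgroup_finite[OF J(1)] J(2)] by simp
  qed
  note BM = commutators_in_maximal[OF B(1,3) B_max]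
  have DB: "core \<subseteq> B" and HB: "H \<subseteq> B" using set_mult_ub[OF core_sub Hs] B(2) by blast+
  \<comment> \<open>An \<open>s\<close>-subgroup of \<open>M\<close> lies in \<open>S\<close>, so
    the intersection lies in that of two distinct conjugates of \<open>S\<close>.\<close>
  have ti: "M \<inter> conj_set x S \<subseteq> core" if x: "x \<in> carrier G" "x \<notin> M" for x
  proof -
    note X = conj_set_S[OF x(1)]
    have ne: "conj_set x S \<noteq> S" using x M_eq unfolding normaliser_def by blast
    have I: "subgroup (M \<inter> conj_set x S) G" by (rule subgroup_Int[OF M(1) X(1)])
    obtain i where i: "card (M \<inter> conj_set x S) = s ^ i" using X(2) p_subgroup_sub[OF s I X(1) inf_le2] by blast
    have "M \<inter> conj_set x S \<subseteq> S" by (rule s_subgroup_le[OF I inf_le1 i])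
    then show ?thesis using trivial_intersection[OF L min SL x(1) ne] by blast
  qed
  let ?Q = "(G\<lparr>carrier := M\<rparr>) Mod B"
  obtain V where V: "V \<in> hom G ?Q" and VS: "\<forall>u\<in>S. V u = B #> u" and VD: "\<forall>d\<in>core. V d = B"
    using transfer_evaluation[OF BM core(1) DB Ss S_normal(1) ti] by blast
  note MA = Mod_abelian[OF BM]
  interpret A: comm_group ?Q by (rule MA(1))
  interpret V: group_hom G ?Q V by unfold_locales (rule V)
  let ?N = "kernel G ?Q V"
  have Nn: "normal_in ?N (carrier G)" using V.normal_kernel unfolding normal_iff .
  have N: "x \<in> ?N \<longleftrightarrow> x \<in> carrier G \<and> V x = B" for x unfolding kernel_def by simp
  have "L \<inter> ?N = core \<or> L \<inter> ?N = L"
    by (rule min[rule_format, OF normal_in_Int[OF L(1) Nn]]) (use L(3) N VD subgroup_carr[OF core_sub] in blast)+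
  then show False
  proof
    assume eq: "L \<inter> ?N = L"
    have "S \<subseteq> B"
    proof
      fix u assume u: "u \<in> S"
      then have "u \<in> ?N" using SL eq by blast
      then have "B #> u = B" using N VS u by simp
      then show "u \<in> B" using rcos_self[OF _ B(1), of u] u subgroup_carr[OF Ss] by blast
    qed
    then have "M \<subseteq> B" using set_mult_least[OF B(1) HB] H(3) by blast
    then show False using B(3) by blast
  next
    assume eq: "L \<inter> ?N = core"
    \<comment> \<open>Since \<open>M = H <#> S\<close> and \<open>H\<close> lies in
      \<open>B\<close>, each value of \<open>V\<close> is already taken at some \<open>u\<close> in
      \<open>S\<close>. Then \<open>l \<otimes> inv u\<close> lies in both \<open>L\<close> and the
      kernel, hence in the core.\<close>
    have "L \<subseteq> M"
    proof
      fix l assume l: "l \<in> L"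
      have lc: "l \<in> carrier G" using l subgroup_carr[OF Ls] by blast
      have "V l \<in> (\<lambda>x. B #> x) ` M" using V.hom_closed[OF lc] MA(5) by blast
      then obtain m where m: "m \<in> M" "V l = B #> m" by blast
      obtain h u where hu: "h \<in> H" "u \<in> S" "m = h \<otimes> u" using m(1) H(3) unfolding set_mult_mem[symmetric]
        by (metis set_mult_mem)
      have uM: "u \<in> M" using hu(2) S_normal(1) by blast
      have c: "h \<in> carrier G" "u \<in> carrier G" using hu subgroup_carr[OF Hs] subgroup_carr[OF Ss] by auto
      have "m \<otimes> inv u = h" using hu(3) c by (simp add: grp)
      then have "B #> m = B #> u" using MA(3)[OF m(1) uM] hu(1) HB by auto
      then have Vlu: "V l = V u" using m(2) VS hu(2) by simp
      have "V (l \<otimes> inv u) = V l \<otimes>\<^bsub>?Q\<^esub> inv\<^bsub>?Q\<^esub> V u" using lc c by (simp only: V.hom_mult V.hom_inv inv_closed)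
      also have "\<dots> = \<one>\<^bsub>?Q\<^esub>" unfolding Vlu by (rule A.r_inv[OF V.hom_closed[OF c(2)]])
      finally have "V (l \<otimes> inv u) = B" unfolding MA(4) .
      then have "l \<otimes> inv u \<in> ?N" using N lc c by simp
      moreover have "l \<otimes> inv u \<in> L"
        using l hu(2) SL by (intro subgroup.m_closed[OF Ls] subgroup.m_inv_closed[OF Ls]) auto
      ultimately have "l \<otimes> inv u \<in> M" using eq core(2) by blast
      then have "(l \<otimes> inv u) \<otimes> u \<in> M" using subgroup.m_closed[OF M(1)] uM by blast
      then show "l \<in> M" using lc c by (simp add: grp)
    qed
    then show False using L(2) by blast
  qed
qed

text \<open>Least order among the normal subgroups that contain the core and are not inside
  \<open>M\<close> makes \<open>L\<close> minimal above the core: a smaller candidate inside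
  \<open>M\<close> is contained in the core. So \<open>prime_dvd_minimal_index\<close> supplies the
  hypothesis of \<open>normal_supplement\<close>.\<close>

lemma exists_normal_supplement:
  "\<exists>t Q k. Factorial_Ring.prime t \<and> subgroup Q G \<and> card Q = t ^ k \<and>
    normal_in (Z <#> Q) (carrier G) \<and> (Z <#> Q) <#> M = carrier G"
proof -
  let ?P = "\<lambda>L. normal_in L (carrier G) \<and> core \<subseteq> L \<and> \<not> L \<subseteq> M"
  have "?P (carrier G)"
    using subgroup_self subgroup_carr[OF core_sub] subgroup_carr[OF M(1)] M(2) unfolding normal_in_def by auto
  then have "\<exists>L. ?P L \<and> (\<forall>N. ?P N \<longrightarrow> card L \<le> card N)" by (rule ex_has_least_nat)
  then obtain L where L: "normal_in L (carrier G)" "core \<subseteq> L" "\<not> L \<subseteq> M"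
    and least: "\<forall>N. ?P N \<longrightarrow> card L \<le> card N" by blast
  have "N = core \<or> N = L" if N: "normal_in N (carrier G)" "core \<subseteq> N" "N \<subseteq> L" for N
  proof (cases "N \<subseteq> M")
    case True
    then show ?thesis using core(3)[OF N(1)] N(2) by blast
  next
    case False
    then have "card L \<le> card N" using least N by blast
    then show ?thesis using card_seteq[OF subgroup_finite[OF normal_inD(1)[OF L(1)]] N(3)] by blast
  qed
  then have "s dvd card (carrier G) div card L" by (intro prime_dvd_minimal_index[OF L(1,3,2)]) blast
  then show ?thesis by (rule normal_supplement[OF L(1,3,2)])
qed

text \<open>The exception \<open>t\<close> is the prime of the group \<open>Q\<close> in the
  supplement. For a prime \<open>q\<close> other than \<open>r\<close>, multiplying
  \<open>Z <#> Q\<close> by a Sylow \<open>q\<close>-subgroup of \<open>M\<close> gives a normal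
  subgroup of order prime to \<open>r\<close> and index prime to \<open>q\<close>, as
  \<open>normal_complementI\<close> asks.\<close>

lemma exists_exceptional_prime:
  "\<exists>t. \<forall>r. Factorial_Ring.prime r \<and> r \<noteq> t \<and> \<not> r dvd card Z \<longrightarrow> q_nilpotent G r"
proof -
  obtain t Q k where t: "Factorial_Ring.prime t" and Q: "subgroup Q G" "card Q = t ^ k"
    and Yn: "normal_in (Z <#> Q) (carrier G)" and YM: "(Z <#> Q) <#> M = carrier G"
    using exists_normal_supplement by blast
  let ?Y = "Z <#> Q"
  note Y = normal_inD(1)[OF Yn]
  have "q_nilpotent G r" if r: "Factorial_Ring.prime r" "r \<noteq> t" "\<not> r dvd card Z" for r
  proof -
    have "\<exists>H k. normal_in H (carrier G) \<and> coprime (card H) r \<and> card (carrier G) = r ^ k * card H"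
    proof (rule normal_complementI[OF r(1) subgroup_self])
      fix q assume q: "Factorial_Ring.prime q" "q \<noteq> r"
      obtain R where R: "sylow_in q R M" using sylow_exists[OF q(1) M(1)] by blast
      note Rs = sylow_inD[OF R]
      have RM: "normal_in R M" by (rule nilpotent_in_sylow_normal[OF q(1) M_nilp R])
      let ?N = "?Y <#> R"
      have N: "subgroup ?N G" by (rule set_mult_subgroup[OF Y Rs(1) le_normaliser_normal[OF Yn Rs(1)]])
      note ub = set_mult_ub[OF Y Rs(1)]
      \<comment> \<open>\<open>?N\<close> is normalized by \<open>M\<close>, where \<open>R\<close>
        is normal, and by its own subgroup \<open>?Y\<close>; these two generate
        \<open>G\<close>.\<close>
      have "M \<subseteq> normaliser ?N"
        using normaliser_set_mult[OF subgroup_carr[OF Y] subgroup_carr[OF Rs(1)]]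
          le_normaliser_normal[OF Yn M(1)] normal_inD(5)[OF RM] by blast
      moreover have "?Y \<subseteq> normaliser ?N" using ub(1) normaliser_self[OF N] by blast
      ultimately have "carrier G \<subseteq> normaliser ?N"
        using set_mult_least[OF normaliser_subgroup[OF subgroup_carr[OF N]]] YM by blast
      then have Nn: "normal_in ?N (carrier G)"
        unfolding normal_in_iff using N subgroup_carr subgroup_self by blast
      obtain j where j: "card R = q ^ j" using Rs(4) by blast
      have "coprime (card Z) r" using r by (metis coprime_commute prime_imp_coprime)
      then have cop: "coprime (card Z * card Q * card R) r"
        using primes_coprime[OF t r(1)] primes_coprime[OF q(1) r(1) q(2)] r(2) Q(2) j by auto
      have "card ?N dvd card Z * card Q * card R"
        by (rule dvd_trans[OF card_set_mult_dvd[OF Y Rs(1)] mult_dvd_mono[OF card_set_mult_dvd[OF Zs Q(1)] dvd_refl]])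
      then have co: "coprime (card ?N) r" by (rule coprime_divisors[OF _ dvd_refl cop])
      \<comment> \<open>The index of \<open>?N\<close> in \<open>G\<close> thus becomes an index in
        \<open>M\<close>, where it divides that of the Sylow subgroup \<open>R\<close>.\<close>
      have "?Y <#> M \<subseteq> ?N <#> M" using ub(1) by (rule mono_set_mult) simp
      then have "?N <#> M = carrier G" using YM set_mult_closed[OF subgroup_carr[OF N] subgroup_carr[OF M(1)]] by simp
      then have "card (carrier G) div card ?N = card M div card (?N \<inter> M)"
        using card_set_mult_div[OF N M(1)] subgroup_self by simp
      moreover have "card M div card R = (card M div card (?N \<inter> M)) * (card (?N \<inter> M) div card R)"
        by (rule card_div_mult[OF Rs(1) subgroup_Int[OF N M(1)] M(1)]) (use ub(2) Rs(3) in blast)+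
      ultimately have "\<not> q dvd card (carrier G) div card ?N" using Rs(5) by (metis dvd_mult2)
      then show "\<exists>N. normal_in N (carrier G) \<and> coprime (card N) r \<and> \<not> q dvd card (carrier G) div card N"
        using Nn co by blast
    qed
    then show ?thesis unfolding q_nilpotent_def normal_iff order_def by blast
  qed
  then show ?thesis by blast
qed

end

section \<open>Reduction to a nilpotent normalizer, and the cases of the theorem\<close>

context fin_group
begin

text \<open>A maximal subgroup \<open>M\<close> above the normalizer of \<open>Z <#> S\<close> also
  contains the normalizer of \<open>S\<close>, so by the Frattini argument it is not normal. Hence
  it is nilpotent, its Sylow subgroup \<open>S\<close> is normal in it, and \<open>M\<close> is the
  normalizer of \<open>S\<close>.\<close>

lemma exceptional_prime:
  assumes s: "Factorial_Ring.prime s" and Z: "normal_in Z (carrier G)" and S: "sylow_in s S (carrier G)"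
    and nn: "\<not> normal_in (Z <#> S) (carrier G)"
    and cases: "\<And>K. \<lbrakk>maximal_subgroup G K; Z \<subseteq> K; s dvd card K\<rbrakk> \<Longrightarrow> normal_in K (carrier G) \<or> nilpotent_in K"
  shows "\<exists>t. \<forall>r. Factorial_Ring.prime r \<and> r \<noteq> t \<and> \<not> r dvd card Z \<longrightarrow> q_nilpotent G r"
proof -
  note Zs = normal_inD(1)[OF Z] and Ss = sylow_inD[OF S]
  let ?Y = "Z <#> S"
  have Y: "subgroup ?Y G" by (rule set_mult_subgroup[OF Zs Ss(1) le_normaliser_normal[OF Z Ss(1)]])
  note ub = set_mult_ub[OF Zs Ss(1)]
  have "normaliser ?Y \<noteq> carrier G" using nn normaliser_carrier_iff[OF Y] by blast
  then obtain M where M: "maximal_subgroup G M" "normaliser ?Y \<subseteq> M"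
    using maximal_subgroup_exists[OF normaliser_subgroup[OF subgroup_carr[OF Y]]] by blast
  note Mm = maximalD[OF M(1)]
  have SY: "normaliser S \<subseteq> normaliser ?Y"
    using normaliser_set_mult[OF subgroup_carr[OF Zs] subgroup_carr[OF Ss(1)]]
      le_normaliser_normal[OF Z normaliser_subgroup[OF subgroup_carr[OF Ss(1)]]] by blast
  have YM: "Z \<subseteq> M" "S \<subseteq> M" using ub normaliser_self[OF Y] M(2) by blast+
  have "normal_in (carrier G) (carrier G)" unfolding normal_in_def using subgroup_self by simp
  then have "\<not> normal_in M (carrier G)"
    using frattini_normal[OF s _ S, of M] SY M(2) Mm(2) by blast
  moreover have "s dvd card M"
  proof -
    \<comment> \<open>That \<open>s\<close> divides \<open>card S\<close> comes from
      \<open>nn\<close>: a trivial \<open>S\<close> would lie in \<open>Z\<close> and make the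
      product equal to the normal subgroup \<open>Z\<close>.\<close>
    have "\<not> S \<subseteq> Z"
    proof
      assume "S \<subseteq> Z"
      then have "?Y = Z" using set_mult_least[OF Zs order_refl] ub(1) by blast
      then show False using nn Z by simp
    qed
    then have "s dvd card S"
      using prime_dvd_card_pgroup[OF Ss(1) _ subgroup.one_closed[OF Zs]] Ss(4) by blast
    then show ?thesis using subgroup_card_dvd[OF Ss(1) Mm(1) YM(2)] by (rule dvd_trans)
  qed
  ultimately have Mn: "nilpotent_in M" using cases[OF M(1) YM(1)] by blast
  have "card (carrier G) div card S = (card (carrier G) div card M) * (card M div card S)"
    by (rule card_div_mult[OF Ss(1) Mm(1) subgroup_self YM(2) subgroup_carr[OF Mm(1)]])
  then have "sylow_in s S M" using S YM(2) Mm(1) unfolding sylow_in_def by (metis dvd_mult)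
  then have "M \<subseteq> normaliser S" using normal_inD(5)[OF nilpotent_in_sylow_normal[OF s Mn]] by blast
  then have "M = normaliser S" using SY M(2) by blast
  then interpret sylow_normalizer _ s Z S M
    by unfold_locales (use s Z S YM(1) M(1) Mn cases in auto)
  show ?thesis by (rule exists_exceptional_prime)
qed

end

theorem theorem1p7:
  fixes G (structure) and p :: nat
  assumes "group G" and "finite (carrier G)"
    and "Factorial_Ring.prime p" and "p dvd order G"
    and "\<forall>M. maximal_subgroup G M \<longrightarrow>
           nilpotent_group (G\<lparr>carrier := M\<rparr>) \<or> M \<lhd> G \<or> \<not> p dvd card M"
  shows "card {q :: nat. Factorial_Ring.prime q \<and> q dvd order G \<and> q \<noteq> p \<and>
                 \<not> q_nilpotent G q \<and> \<not> q_closed G q} \<le> 1"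
proof -
  interpret fin_group G using assms(1,2) by (simp add: fin_group_def fin_group_axioms_def)
  note p = assms(3)
  have maxc: "normal_in K (carrier G) \<or> nilpotent_in K" if "maximal_subgroup G K" "p dvd card K" for K
    using assms(5) that nilpotent_imp_nilp[OF _ maximalD(1)[OF that(1)]] unfolding normal_iff by blast
  have "\<exists>t. \<forall>r. Factorial_Ring.prime r \<and> r \<noteq> t \<and> r \<noteq> p \<longrightarrow> q_nilpotent G r"
  proof -
    obtain P where P: "sylow_in p P (carrier G)" using sylow_exists[OF p subgroup_self] by blast
    note Ps = sylow_inD[OF P]
    obtain k where k: "card P = p ^ k" using Ps(4) by blast
    have "card (carrier G) = card (carrier G) div card P * card P" by (rule card_div(1)[OF Ps(1,2,3)])
    then have pP: "p dvd card P" using assms(4) Ps(5) p unfolding order_def by (metis prime_dvd_mult_iff)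
    have rP: "\<not> r dvd card P" if "Factorial_Ring.prime r" "r \<noteq> p" for r
      using that p k by (metis prime_dvd_power primes_dvd_imp_eq)
    consider (nonnormal) "\<not> normal_in P (carrier G)"
      | (mixed) q Q where "normal_in P (carrier G)" "Factorial_Ring.prime q" "sylow_in q Q (carrier G)"
          "\<not> normal_in (P <#> Q) (carrier G)"
      | (nilpotent) "normal_in P (carrier G)" "\<And>q Q. Factorial_Ring.prime q \<Longrightarrow> sylow_in q Q (carrier G) \<Longrightarrow>
          normal_in (P <#> Q) (carrier G)"
      by blast
    then show ?thesis
    proof cases
      case nonnormal
      \<comment> \<open>With \<open>Z\<close> trivial, the condition that \<open>r\<close> does not
        divide \<open>card Z\<close> holds for every prime \<open>r\<close>.\<close>
      have one: "normal_in {\<one>} (carrier G)" using normal_iff one_is_normal by blast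
      have "{\<one>} <#> P = P" using subgroup_carr[OF Ps(1)] unfolding set_mult_def by force
      then have nn: "\<not> normal_in ({\<one>} <#> P) (carrier G)" using nonnormal by simp
      have "\<exists>t. \<forall>r. Factorial_Ring.prime r \<and> r \<noteq> t \<and> \<not> r dvd card {\<one>} \<longrightarrow> q_nilpotent G r"
        by (rule exceptional_prime[OF p one P nn maxc])
      moreover have "\<not> r dvd card {\<one>}" if "Factorial_Ring.prime r" for r :: nat
        using that not_prime_unit by auto
      ultimately show ?thesis by blast
    next
      case mixed
      \<comment> \<open>Every subgroup above \<open>P\<close> has order divisible by
        \<open>p\<close>, so \<open>maxc\<close> controls all maximal subgroups above
        \<open>P\<close>, whatever the prime \<open>q\<close> is.\<close>
      have "normal_in K (carrier G) \<or> nilpotent_in K" if "maximal_subgroup G K" "P \<subseteq> K" for K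
        using maxc[OF that(1)] dvd_trans[OF pP subgroup_card_dvd[OF Ps(1) maximalD(1)[OF that(1)] that(2)]] by blast
      from exceptional_prime[OF mixed(2,1,3,4) this] show ?thesis using rP by blast
    next
      case nilpotent
      \<comment> \<open>Here the normal subgroups \<open>P <#> Q\<close>, for the primes
        \<open>q\<close> other than \<open>r\<close>, are directly the ingredients of
        \<open>normal_complementI\<close>.\<close>
      have "q_nilpotent G r" if r: "Factorial_Ring.prime r" "r \<noteq> p" for r
      proof -
        have "\<exists>H k. normal_in H (carrier G) \<and> coprime (card H) r \<and> card (carrier G) = r ^ k * card H"
        proof (rule normal_complementI[OF r(1) subgroup_self])
          fix q assume q: "Factorial_Ring.prime q" "q \<noteq> r"
          obtain Q where Q: "sylow_in q Q (carrier G)" using sylow_exists[OF q(1) subgroup_self] by blast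
          note Qs = sylow_inD[OF Q] and N = nilpotent(2)[OF q(1) Q]
          obtain j where j: "card Q = q ^ j" using Qs(4) by blast
          have "coprime (card P * card Q) r"
            using primes_coprime[OF p r(1)] primes_coprime[OF q(1) r(1) q(2)] r(2) k j by auto
          then have "coprime (card (P <#> Q)) r"
            by (rule coprime_divisors[OF card_set_mult_dvd[OF Ps(1) Qs(1)] dvd_refl])
          moreover have "card (carrier G) div card Q =
              (card (carrier G) div card (P <#> Q)) * (card (P <#> Q) div card Q)"
            using card_div_mult[OF Qs(1) normal_inD(1)[OF N] subgroup_self set_mult_ub(2)[OF Ps(1) Qs(1)]
                normal_inD(3)[OF N]] .
          then have "\<not> q dvd card (carrier G) div card (P <#> Q)" using Qs(5) by (metis dvd_mult2)
          ultimately show "\<exists>N. normal_in N (carrier G) \<and> coprime (card N) r \<and>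
              \<not> q dvd card (carrier G) div card N" using N by blast
        qed
        then show ?thesis unfolding q_nilpotent_def normal_iff order_def by blast
      qed
      then show ?thesis by blast
    qed
  qed
  then obtain t where "\<forall>r. Factorial_Ring.prime r \<and> r \<noteq> t \<and> r \<noteq> p \<longrightarrow> q_nilpotent G r" by blast
  then have "{q :: nat. Factorial_Ring.prime q \<and> q dvd order G \<and> q \<noteq> p \<and>
      \<not> q_nilpotent G q \<and> \<not> q_closed G q} \<subseteq> {t}" by blast
  from card_mono[OF _ this] show ?thesis by simp
qed

end
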